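(* Let $d,m\in\mathbb{N}$, let $p_1,\ldots,p_m\in\mathbb{R}[x]\setminus\{0\}$ and let $A:=(p_1,\ldots,p_m)_{>0}$. Let $f\in\mathbb{R}[x]$ be a polynomial irreducible over $\mathbb{R}[x]$. Assume that there exist $b\in Z(f)$ and $\varepsilon>0$ such that $$\dim(\operatorname{bd} A\cap Z(f)\cap B^d(b,\varepsilon)) = d-1,\qquad B^d(b,\varepsilon)\setminus Z(f)=A\cap B^d(b,\varepsilon).$$ Then $f$ is a factor of $p_i$ for some $i\in\{1,\ldots,m\}$ and, for every $i\in\{1,\ldots,m\}$ such that $p_i$ is divisible by $f$, the factor $f$ of $p_i$ has even multiplicity.
   Context: $\mathbb{R}[x]=\mathbb{R}[x_1,\ldots,x_d]$ is the ring of real polynomials in $d$ variables. $(p_1,\ldots,p_m)_{> 0}=\{x\in\mathbb{R}^d: p_1(x)> 0,\ldots,p_m(x)> 0\}$ and $Z(f)=\{x\in\mathbb{R}^d: f(x)=0\}$. $B^d(c,\rho)$ is the open Euclidean ball in $\mathbb{R}^d$ with center $c$ and radius $\rho$; $\operatorname{bd}$ denotes the topological boundary in $\mathbb{R}^d$. The dimension $\dim S$ of a semi-algebraic set $S\subseteq\mathbb{R}^d$ is the Krull dimension of the ring $\mathbb{R}[x]/\mathcal{I}(S)$, where $\mathcal{I}(S)=\{p\in\mathbb{R}[x]: p(x)=0 \text{ for all } x\in S\}$ (the usual semi-algebraic dimension, with the zero ring, i.e. $S=\emptyset$, having negative dimension). A polynomial is irreducible over $\mathbb{R}[x]$ if it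 is non-constant and is not a product of two non-constant polynomials in $\mathbb{R}[x]$. $p$ is a factor of $q$ if $q=pg$ for some $g\in\mathbb{R}[x]$. An irreducible factor $f$ of $p$ has multiplicity $k\in\mathbb{N}$ ($k\ge1$) if $f^k$ is a factor of $p$ but $f^{k+1}$ is not. *)

theory Defs
  imports
    "HOL-Analysis.Analysis"
    "HOL-Library.Poly_Mapping"
    "HOL-Algebra.Algebraic_Closure_Type"
begin

text \<open>
  Real polynomials in the variables \<open>x\<^sub>i\<close>, \<open>i :: 'n\<close>, so that \<open>d = CARD('n)\<close>: finitely supported
  maps from exponent vectors to coefficients, with the convolution product of
  \<^theory>\<open>HOL-Library.Poly_Mapping\<close>.
\<close>

type_synonym 'n mpoly = "('n \<Rightarrow>\<^sub>0 nat) \<Rightarrow>\<^sub>0 real"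

definition eval_mpoly :: "'n::finite mpoly \<Rightarrow> real ^ 'n \<Rightarrow> real" where
  "eval_mpoly p x =
     (\<Sum>\<alpha>\<in>Poly_Mapping.keys p.
        Poly_Mapping.lookup p \<alpha> * (\<Prod>i\<in>UNIV. (x $ i) ^ Poly_Mapping.lookup \<alpha> i))"

definition constant_mpoly :: "'n mpoly \<Rightarrow> bool" where
  "constant_mpoly p \<longleftrightarrow> (\<exists>c. p = Poly_Mapping.single 0 c)"

definition irreducible_mpoly :: "'n mpoly \<Rightarrow> bool" where
  "irreducible_mpoly f \<longleftrightarrow> \<not> constant_mpoly f \<and>
     \<not> (\<exists>g h. \<not> constant_mpoly g \<and> \<not> constant_mpoly h \<and> f = g * h)"

definition has_multiplicity :: "'n mpoly \<Rightarrow> 'n mpoly \<Rightarrow> nat \<Rightarrow> bool" where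
  "has_multiplicity f p k \<longleftrightarrow> k \<ge> 1 \<and> f ^ k dvd p \<and> \<not> f ^ (k + 1) dvd p"

definition zero_set :: "'n::finite mpoly \<Rightarrow> (real ^ 'n) set" where
  "zero_set f = {x. eval_mpoly f x = 0}"

definition positivity_set :: "nat \<Rightarrow> (nat \<Rightarrow> 'n::finite mpoly) \<Rightarrow> (real ^ 'n) set" where
  "positivity_set m p = {x. \<forall>i\<in>{1..m}. eval_mpoly (p i) x > 0}"

definition vanishing_ideal :: "(real ^ 'n::finite) set \<Rightarrow> 'n mpoly set" where
  "vanishing_ideal S = {p. \<forall>x\<in>S. eval_mpoly p x = 0}"

text \<open>
  The supremum of the lengths \<open>n\<close> of strict chains \<open>P 0 \<subset> \<dots> \<subset> P n\<close> of prime ideals. Since prime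
  ideals are proper, the zero ring has none, and its dimension is \<open>- \<infinity>\<close>.
\<close>

definition krull_dim :: "('a, 'b) ring_scheme \<Rightarrow> ereal" where
  "krull_dim R = Sup {ereal (real n) | n.
     \<exists>P. (\<forall>i\<le>n. primeideal (P i) R) \<and> (\<forall>i<n. P i \<subset> P (Suc i))}"

text \<open>Meant for semi-algebraic \<open>S\<close>, though the definition makes sense for every set.\<close>

definition semialg_dim :: "(real ^ 'n::finite) set \<Rightarrow> ereal" where
  "semialg_dim S = krull_dim ((ring_of_type_algebra :: 'n mpoly ring) Quot vanishing_ideal S)"

lemma eval_mpoly_superset:
  assumes "finite K" "Poly_Mapping.keys p \<subseteq> K"
  shows "eval_mpoly p x =
     (\<Sum>\<alpha>\<in>K. Poly_Mapping.lookup p \<alpha> * (\<Prod>i\<in>UNIV. (x $ i) ^ Poly_Mapping.lookup \<alpha> i))"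
  unfolding eval_mpoly_def
  by (rule sum.mono_neutral_left) (use assms in \<open>auto simp: in_keys_iff\<close>)

lemma eval_mpoly_zero [simp]: "eval_mpoly 0 x = 0"
  by (simp add: eval_mpoly_def)

lemma eval_mpoly_single [simp]:
  "eval_mpoly (Poly_Mapping.single \<alpha> c) x = c * (\<Prod>i\<in>UNIV. (x $ i) ^ Poly_Mapping.lookup \<alpha> i)"
  by (subst eval_mpoly_superset[where K = "{\<alpha>}"]) auto

lemma eval_mpoly_add [simp]: "eval_mpoly (p + q) x = eval_mpoly p x + eval_mpoly q x"
proof -
  let ?K = "Poly_Mapping.keys p \<union> Poly_Mapping.keys q"
  have "Poly_Mapping.keys (p + q) \<subseteq> ?K"
    by (rule Poly_Mapping.keys_add)
  then show ?thesis
    by (simp add: eval_mpoly_superset[where K = ?K] lookup_add distrib_right sum.distrib)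
qed

lemma mpoly_induct:
  fixes p :: "'n mpoly"
  assumes "P 0" "\<And>\<alpha> c q. P q \<Longrightarrow> P (Poly_Mapping.single \<alpha> c + q)"
  shows "P p"
proof (induction "card (Poly_Mapping.keys p)" arbitrary: p)
  case 0
  then show ?case using assms(1) by simp
next
  case (Suc n)
  then obtain \<alpha> where a: "\<alpha> \<in> Poly_Mapping.keys p"
    by fastforce
  define q where "q = p - Poly_Mapping.single \<alpha> (Poly_Mapping.lookup p \<alpha>)"
  have "Poly_Mapping.keys q = Poly_Mapping.keys p - {\<alpha>}"
    by (auto simp: q_def in_keys_iff lookup_minus lookup_single when_def split: if_splits)
  then have "P q"
    using Suc a by simp
  moreover have "p = Poly_Mapping.single \<alpha> (Poly_Mapping.lookup p \<alpha>) + q"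
    by (simp add: q_def)
  ultimately show ?case
    using assms(2) by metis
qed

lemma eval_mpoly_mult [simp]: "eval_mpoly (p * q) x = eval_mpoly p x * eval_mpoly q x"
proof (induction p rule: mpoly_induct)
  case 1
  then show ?case by simp
next
  case (2 \<alpha> c r)
  have "eval_mpoly (Poly_Mapping.single \<alpha> c * q) x = eval_mpoly (Poly_Mapping.single \<alpha> c) x * eval_mpoly q x"
    by (induction q rule: mpoly_induct)
      (simp_all add: distrib_left mult_single lookup_add power_add prod.distrib)
  with 2 show ?case
    by (simp add: distrib_right)
qed

lemma ideal_vanishing_ideal:
  "ideal (vanishing_ideal S) (ring_of_type_algebra :: 'n::finite mpoly ring)"
proof -
  let ?R = "ring_of_type_algebra :: 'n mpoly ring"
  interpret R: cring ?R by (rule cring_from_type_algebra)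
  have eval_minus: "eval_mpoly (- a) x = - eval_mpoly a x" for a :: "'n mpoly" and x
    using eval_mpoly_add[of a "- a" x] by simp
  have inv: "inv\<^bsub>add_monoid ?R\<^esub> a = - a" for a
    using R.minus_equality[of "- a" a] by (simp add: ring_of_type_algebra_def a_inv_def)
  show ?thesis
  proof (rule idealI[OF R.ring_axioms])
    show "subgroup (vanishing_ideal S) (add_monoid ?R)"
    proof
      show "inv\<^bsub>add_monoid ?R\<^esub> a \<in> vanishing_ideal S" if "a \<in> vanishing_ideal S" for a
        unfolding inv using that by (simp add: vanishing_ideal_def eval_minus)
    qed (auto simp: vanishing_ideal_def ring_of_type_algebra_def)
  qed (auto simp: vanishing_ideal_def ring_of_type_algebra_def)
qed

end

theory Submission
  imports Defs
begin

text \<open>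
  Write \<open>S\<close> for the part of the boundary of \<open>A\<close> on \<open>Z(f)\<close> inside the ball. Everything rests on one
  algebraic consequence of \<open>dim S = d - 1\<close>: every polynomial that vanishes on \<open>S\<close> is divisible by
  \<open>f\<close> (lemma \<open>dvd_if_vanishes_on_hypersurface_piece\<close>). The dimension provides a chain
  \<open>P\<^sub>0 \<subset> \<dots> \<subset> P\<^bsub>d-1\<^esub>\<close> of prime ideals that contain the vanishing ideal of \<open>S\<close>. If some \<open>h\<close> in that
  ideal were not a multiple of \<open>f\<close>, then \<open>0 \<subset> (f) \<subset> P\<^sub>0 \<subset> \<dots> \<subset> P\<^bsub>d-1\<^esub>\<close> would be a strict chain of
  \<open>d + 2\<close> prime ideals in a ring of Krull dimension at most \<open>d\<close>.

  Two facts about the polynomial ring are needed for this. The ideal \<open>(f)\<close> is prime because the ring is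
  factorial; this is Gauss's lemma, by induction on the set of variables
  (\<open>irreducible_imp_prime_in\<close>). The bound on chains (\<open>prime_chain_length_bound\<close>) follows from the
  algebraic dependence of any \<open>d + 1\<close> polynomials: if the \<open>k\<close>-th of them is chosen in the \<open>(k + 1)\<close>-st
  prime ideal of the chain but not in the \<open>k\<close>-th, then removing the lowest power of one polynomial
  after the other from a relation puts a nonzero constant into the last prime ideal.

  The theorem follows by applying the divisibility result twice. At a boundary point of \<open>A\<close> some \<open>p\<^sub>i\<close>
  vanishes, so \<open>f\<close> divides the product of the \<open>p\<^sub>i\<close> and hence one of them. If \<open>p\<^sub>i = f\<^sup>k g\<close> with \<open>k\<close> odd
  and \<open>f\<close> not dividing \<open>g\<close>, then \<open>p\<^sub>i > 0\<close> off \<open>Z(f)\<close> makes \<open>f g \<ge> 0\<close> on the whole ball. So \<open>f g\<close> is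
  minimal at every point of \<open>S\<close>, and its partial derivatives vanish there. Therefore \<open>f\<close> divides
  \<open>(\<partial>\<^sub>v f) g + f (\<partial>\<^sub>v g)\<close>, hence \<open>\<partial>\<^sub>v f\<close>. For a variable \<open>v\<close> that occurs in \<open>f\<close> this contradicts the
  degree in \<open>v\<close>.
\<close>

section \<open>Constant polynomials\<close>

definition const_mpoly :: "real \<Rightarrow> 'n mpoly" where
  "const_mpoly c = Poly_Mapping.single 0 c"

lemma const_mpoly_0 [simp]: "const_mpoly 0 = 0"
  by (simp add: const_mpoly_def)

lemma const_mpoly_1 [simp]: "const_mpoly 1 = 1"
  by (simp add: const_mpoly_def)

lemma const_mpoly_mult: "const_mpoly a * const_mpoly b = const_mpoly (a * b)"
  by (simp add: const_mpoly_def mult_single)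

lemma const_mpoly_eq_0_iff [simp]: "const_mpoly c = 0 \<longleftrightarrow> c = 0"
  by (metis const_mpoly_0 const_mpoly_def lookup_single_eq lookup_zero)

lemma constant_mpoly_iff: "constant_mpoly p \<longleftrightarrow> (\<exists>c. p = const_mpoly c)"
  by (simp add: constant_mpoly_def const_mpoly_def)

lemma constant_mpolyE:
  assumes "constant_mpoly p" "p \<noteq> 0"
  obtains c where "p = const_mpoly c" "c \<noteq> 0" "const_mpoly (1 / c) * p = 1"
proof -
  obtain c where c: "p = const_mpoly c"
    using assms(1) by (auto simp: constant_mpoly_iff)
  with assms(2) have "c \<noteq> 0"
    by auto
  with c that show ?thesis
    by (simp add: const_mpoly_mult)
qed

section \<open>Polynomials as univariate polynomials in one of the variables\<close>

definition var_mpoly :: "'n \<Rightarrow> 'n mpoly" where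
  "var_mpoly v = Poly_Mapping.single (Poly_Mapping.single v 1) 1"

lemma var_mpoly_power: "var_mpoly v ^ k = Poly_Mapping.single (Poly_Mapping.single v k) 1"
  by (induction k) (simp_all add: var_mpoly_def mult_single flip: single_add)

definition remove_var :: "'n \<Rightarrow> ('n \<Rightarrow>\<^sub>0 nat) \<Rightarrow> ('n \<Rightarrow>\<^sub>0 nat)" where
  "remove_var v \<alpha> = \<alpha> - Poly_Mapping.single v (Poly_Mapping.lookup \<alpha> v)"

lemma lookup_remove_var:
  "Poly_Mapping.lookup (remove_var v \<alpha>) i = (if i = v then 0 else Poly_Mapping.lookup \<alpha> i)"
  by (auto simp: remove_var_def lookup_minus lookup_single when_def)

lemma remove_var_add: "remove_var v (\<alpha> + \<beta>) = remove_var v \<alpha> + remove_var v \<beta>"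
  by (rule poly_mapping_eqI) (simp add: lookup_remove_var lookup_add)

lemma remove_var_plus_single: "remove_var v \<alpha> + Poly_Mapping.single v (Poly_Mapping.lookup \<alpha> v) = \<alpha>"
  by (rule poly_mapping_eqI) (simp add: lookup_remove_var lookup_add lookup_single when_def)

text \<open>
  The ring embedding that collects the powers of \<open>x\<^sub>v\<close>. Its coefficients have the same type as the
  polynomials themselves, although \<open>x\<^sub>v\<close> does not occur in them, so the number of variables does not
  show in the types and inductions on sets of variables are possible.
\<close>

definition univ_in :: "'n \<Rightarrow> 'n mpoly \<Rightarrow> 'n mpoly poly" where
  "univ_in v p = (\<Sum>\<alpha>\<in>Poly_Mapping.keys p.
     Polynomial.monom (Poly_Mapping.single (remove_var v \<alpha>) (Poly_Mapping.lookup p \<alpha>)) (Poly_Mapping.lookup \<alpha> v))"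

lemma univ_in_superset:
  assumes "finite K" "Poly_Mapping.keys p \<subseteq> K"
  shows "univ_in v p = (\<Sum>\<alpha>\<in>K.
     Polynomial.monom (Poly_Mapping.single (remove_var v \<alpha>) (Poly_Mapping.lookup p \<alpha>)) (Poly_Mapping.lookup \<alpha> v))"
  unfolding univ_in_def
  by (rule sum.mono_neutral_left) (use assms in \<open>auto simp: in_keys_iff\<close>)

lemma univ_in_0 [simp]: "univ_in v 0 = 0"
  by (simp add: univ_in_def)

lemma univ_in_single:
  "univ_in v (Poly_Mapping.single \<alpha> c) =
     Polynomial.monom (Poly_Mapping.single (remove_var v \<alpha>) c) (Poly_Mapping.lookup \<alpha> v)"
  by (subst univ_in_superset[where K = "{\<alpha>}"]) auto

lemma univ_in_add: "univ_in v (p + q) = univ_in v p + univ_in v q"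
proof -
  let ?K = "Poly_Mapping.keys p \<union> Poly_Mapping.keys q"
  have "Poly_Mapping.keys (p + q) \<subseteq> ?K"
    by (rule Poly_Mapping.keys_add)
  then show ?thesis
    by (simp add: univ_in_superset[where K = ?K] lookup_add single_add sum.distrib flip: add_monom)
qed

lemma univ_in_mult: "univ_in v (p * q) = univ_in v p * univ_in v q"
proof (induction p rule: mpoly_induct)
  case 1
  then show ?case by simp
next
  case (2 \<alpha> c r)
  have "univ_in v (Poly_Mapping.single \<alpha> c * q) = univ_in v (Poly_Mapping.single \<alpha> c) * univ_in v q"
    by (induction q rule: mpoly_induct)
      (simp_all add: distrib_left mult_single lookup_add univ_in_add univ_in_single mult_monom remove_var_add)
  with 2 show ?case
    by (simp add: distrib_right univ_in_add)
qed

lemma poly_univ_in [simp]: "poly (univ_in v p) (var_mpoly v) = p"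
  by (induction p rule: mpoly_induct)
    (simp_all add: univ_in_add univ_in_single poly_monom var_mpoly_power mult_single remove_var_plus_single)

lemma univ_in_eq_0_iff [simp]: "univ_in v p = 0 \<longleftrightarrow> p = 0"
  by (metis poly_0 poly_univ_in univ_in_0)

lemma univ_in_var_power: "univ_in v (var_mpoly v ^ k) = Polynomial.monom 1 k"
proof -
  have "remove_var v (Poly_Mapping.single v k) = 0"
    by (rule poly_mapping_eqI) (simp add: lookup_remove_var lookup_single when_def)
  then show ?thesis
    by (simp add: var_mpoly_power univ_in_single)
qed

lemma univ_in_uminus: "univ_in v (- p) = - univ_in v p"
  by (metis add.right_inverse add_eq_0_iff univ_in_add univ_in_0)

lemma univ_in_diff: "univ_in v (p - q) = univ_in v p - univ_in v q"
  using univ_in_add[of v p "- q"] by (simp add: univ_in_uminus)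

definition deg_in :: "'n \<Rightarrow> 'n mpoly \<Rightarrow> nat" where
  "deg_in v p = Polynomial.degree (univ_in v p)"

section \<open>Polynomials in a subset of the variables\<close>

definition polys_in :: "'n set \<Rightarrow> 'n mpoly set" where
  "polys_in V = {p. \<forall>\<alpha>\<in>Poly_Mapping.keys p. Poly_Mapping.keys \<alpha> \<subseteq> V}"

lemma polys_in_UNIV [simp]: "p \<in> polys_in UNIV"
  by (simp add: polys_in_def)

lemma polys_in_mono: "V \<subseteq> W \<Longrightarrow> polys_in V \<subseteq> polys_in W"
  by (auto simp: polys_in_def)

lemma polys_in_0 [simp]: "0 \<in> polys_in V"
  by (simp add: polys_in_def)

lemma polys_in_const [simp]: "const_mpoly c \<in> polys_in V"
  by (simp add: polys_in_def const_mpoly_def)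

lemma polys_in_1 [simp]: "1 \<in> polys_in V"
  by (metis const_mpoly_1 polys_in_const)

lemma polys_in_empty: "p \<in> polys_in {} \<longleftrightarrow> constant_mpoly p"
proof
  assume "p \<in> polys_in {}"
  then have "\<forall>\<alpha>\<in>Poly_Mapping.keys p. \<alpha> = 0"
    by (simp add: polys_in_def)
  then have "p = Poly_Mapping.single 0 (Poly_Mapping.lookup p 0)"
    by (intro poly_mapping_eqI) (auto simp: lookup_single when_def in_keys_iff)
  then show "constant_mpoly p"
    by (auto simp: constant_mpoly_def)
qed (auto simp: constant_mpoly_iff)

lemma polys_in_add: "p \<in> polys_in V \<Longrightarrow> q \<in> polys_in V \<Longrightarrow> p + q \<in> polys_in V"
  using Poly_Mapping.keys_add[of p q] by (fastforce simp: polys_in_def)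

lemma polys_in_sum: "(\<And>i. i \<in> I \<Longrightarrow> p i \<in> polys_in V) \<Longrightarrow> sum p I \<in> polys_in V"
  by (induction I rule: infinite_finite_induct) (auto intro: polys_in_add)

lemma polys_in_mult:
  assumes "p \<in> polys_in V" "q \<in> polys_in V"
  shows "p * q \<in> polys_in V"
proof -
  have "Poly_Mapping.keys \<alpha> \<subseteq> V" if a: "\<alpha> \<in> Poly_Mapping.keys (p * q)" for \<alpha>
  proof -
    obtain \<beta> \<gamma> where "\<alpha> = \<beta> + \<gamma>" "\<beta> \<in> Poly_Mapping.keys p" "\<gamma> \<in> Poly_Mapping.keys q"
      using a Poly_Mapping.keys_mult[of p q] by blast
    with assms Poly_Mapping.keys_add[of \<beta> \<gamma>] show ?thesis
      by (fastforce simp: polys_in_def)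
  qed
  then show ?thesis
    by (auto simp: polys_in_def)
qed

lemma polys_in_uminus: "p \<in> polys_in V \<Longrightarrow> - p \<in> polys_in V"
  by (simp add: polys_in_def in_keys_iff)

lemma polys_in_diff: "p \<in> polys_in V \<Longrightarrow> q \<in> polys_in V \<Longrightarrow> p - q \<in> polys_in V"
  using polys_in_add[of p V "- q"] polys_in_uminus[of q V] by simp

lemma polys_in_var_power: "v \<in> V \<Longrightarrow> var_mpoly v ^ k \<in> polys_in V"
  by (simp add: var_mpoly_power polys_in_def)

lemma coeff_univ_in_polys:
  assumes "p \<in> polys_in (insert v V)"
  shows "Polynomial.coeff (univ_in v p) k \<in> polys_in (V - {v})"
proof -
  have "Poly_Mapping.single (remove_var v \<alpha>) (Poly_Mapping.lookup p \<alpha>) \<in> polys_in (V - {v})"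
    if "\<alpha> \<in> Poly_Mapping.keys p" for \<alpha>
  proof -
    have "Poly_Mapping.keys \<alpha> \<subseteq> insert v V"
      using assms that by (simp add: polys_in_def)
    moreover have "Poly_Mapping.keys (remove_var v \<alpha>) \<subseteq> Poly_Mapping.keys \<alpha> - {v}"
      by (auto simp: in_keys_iff lookup_remove_var split: if_splits)
    ultimately have "Poly_Mapping.keys (remove_var v \<alpha>) \<subseteq> V - {v}"
      by blast
    then show ?thesis
      by (simp add: polys_in_def)
  qed
  then show ?thesis
    by (auto simp: univ_in_def coeff_sum intro!: polys_in_sum)
qed

lemma univ_in_free:
  assumes "p \<in> polys_in V" "v \<notin> V"
  shows "univ_in v p = [:p:]"
proof -
  have "Polynomial.monom (Poly_Mapping.single (remove_var v \<alpha>) (Poly_Mapping.lookup p \<alpha>)) (Poly_Mapping.lookup \<alpha> v)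
     = Polynomial.monom (Poly_Mapping.single \<alpha> (Poly_Mapping.lookup p \<alpha>)) 0"
    if "\<alpha> \<in> Poly_Mapping.keys p" for \<alpha>
  proof -
    have "v \<notin> Poly_Mapping.keys \<alpha>"
      using that assms by (auto simp: polys_in_def)
    then have "Poly_Mapping.lookup \<alpha> v = 0"
      by (simp add: in_keys_iff)
    moreover from this have "remove_var v \<alpha> = \<alpha>"
      by (simp add: remove_var_def)
    ultimately show ?thesis by simp
  qed
  then have eq: "univ_in v p = (\<Sum>\<alpha>\<in>Poly_Mapping.keys p. Polynomial.monom (Poly_Mapping.single \<alpha> (Poly_Mapping.lookup p \<alpha>)) 0)"
    unfolding univ_in_def by (intro sum.cong) auto
  have "Polynomial.degree (univ_in v p) = 0"
    unfolding eq by (intro le_zero_eq[THEN iffD1] degree_sum_le) (simp_all add: monom_0)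
  then obtain c where c: "univ_in v p = [:c:]"
    by (rule degree_eq_zeroE)
  then have "poly [:c:] (var_mpoly v) = p"
    by (metis poly_univ_in)
  with c show ?thesis by simp
qed

lemma deg_in_0_iff: "deg_in v p = 0 \<longleftrightarrow> p \<in> polys_in (- {v})"
proof
  assume "deg_in v p = 0"
  then obtain c where c: "univ_in v p = [:c:]"
    unfolding deg_in_def by (rule degree_eq_zeroE)
  then have "poly [:c:] (var_mpoly v) = p"
    by (metis poly_univ_in)
  with c have "Polynomial.coeff (univ_in v p) 0 = p" by simp
  then show "p \<in> polys_in (- {v})"
    using coeff_univ_in_polys[of p v UNIV 0] by (simp add: Compl_eq_Diff_UNIV)
next
  assume "p \<in> polys_in (- {v})"
  then have "univ_in v p = [:p:]"
    by (rule univ_in_free) simp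
  then show "deg_in v p = 0"
    by (simp add: deg_in_def)
qed

lemma polys_in_iff_deg: "p \<in> polys_in V \<longleftrightarrow> (\<forall>v. v \<notin> V \<longrightarrow> deg_in v p = 0)"
  unfolding deg_in_0_iff by (auto simp: polys_in_def)

section \<open>The polynomial ring is an integral domain\<close>

text \<open>
  Variables are adjoined one at a time: the leading coefficient of a product in the new variable is the
  product of the leading coefficients, which is nonzero by induction.
\<close>

lemma no_zero_divisors_polys_in:
  assumes "finite V" "p \<in> polys_in V" "q \<in> polys_in V" "p \<noteq> 0" "q \<noteq> 0"
  shows "p * q \<noteq> 0"
  using assms
proof (induction V arbitrary: p q rule: finite_induct)
  case empty
  then show ?case
    by (auto simp: polys_in_empty constant_mpoly_iff const_mpoly_mult)
next
  case (insert v V)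
  let ?P = "univ_in v p" and ?Q = "univ_in v q"
  have "Polynomial.coeff (univ_in v (p * q)) (Polynomial.degree ?P + Polynomial.degree ?Q)
     = Polynomial.lead_coeff ?P * Polynomial.lead_coeff ?Q"
    by (simp add: univ_in_mult coeff_mult_degree_sum)
  moreover have "Polynomial.lead_coeff ?P * Polynomial.lead_coeff ?Q \<noteq> 0"
    using insert coeff_univ_in_polys[of p v V] coeff_univ_in_polys[of q v V]
    by (intro insert.IH) auto
  ultimately show ?case
    by (metis Polynomial.coeff_0 univ_in_0)
qed

lemma mpoly_mult_eq_0_iff [simp]: "p * q = 0 \<longleftrightarrow> p = 0 \<or> q = 0"
  for p q :: "'n::finite mpoly"
  using no_zero_divisors_polys_in[of UNIV p q] by auto

lemma mpoly_mult_left_cancel: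
  fixes a x y :: "'n::finite mpoly"
  assumes "a \<noteq> 0" "a * x = a * y"
  shows "x = y"
proof -
  have "a * (x - y) = 0"
    using assms(2) by (simp add: right_diff_distrib)
  then show ?thesis
    using assms(1) by simp
qed

lemma deg_in_mult:
  fixes p q :: "'n::finite mpoly"
  assumes "p \<noteq> 0" "q \<noteq> 0"
  shows "deg_in v (p * q) = deg_in v p + deg_in v q"
proof (rule antisym)
  show "deg_in v (p * q) \<le> deg_in v p + deg_in v q"
    unfolding deg_in_def univ_in_mult by (rule degree_mult_le)
  have "Polynomial.coeff (univ_in v (p * q)) (deg_in v p + deg_in v q) \<noteq> 0"
    using assms by (simp add: univ_in_mult coeff_mult_degree_sum deg_in_def)
  then show "deg_in v p + deg_in v q \<le> deg_in v (p * q)"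
    unfolding deg_in_def by (rule le_degree)
qed

text \<open>
  Degrees in a variable outside \<open>V\<close> add up to \<open>0\<close>, so no such variable occurs in a factor.
\<close>

lemma factor_polys_in:
  fixes p q :: "'n::finite mpoly"
  assumes "p * q \<in> polys_in V" "p * q \<noteq> 0"
  shows "p \<in> polys_in V"
proof -
  have "p \<noteq> 0" "q \<noteq> 0"
    using assms(2) by auto
  with assms(1) show ?thesis
    by (auto simp: polys_in_iff_deg deg_in_mult)
qed

text \<open>
  The sum of the degrees in the single variables, not the degree of the largest monomial. Like the
  latter it is additive and vanishes exactly on constants, which is all that the inductions on
  factorisations require.
\<close>

definition total_deg :: "'n::finite mpoly \<Rightarrow> nat" where
  "total_deg p = (\<Sum>v\<in>UNIV. deg_in v p)"

lemma total_deg_mult: "p \<noteq> 0 \<Longrightarrow> q \<noteq> 0 \<Longrightarrow> total_deg (p * q) = total_deg p + total_deg q"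
  by (simp add: total_deg_def deg_in_mult sum.distrib)

lemma total_deg_0_iff: "total_deg p = 0 \<longleftrightarrow> constant_mpoly p"
  by (simp add: total_deg_def polys_in_iff_deg flip: polys_in_empty)

lemma total_deg_power: "p \<noteq> 0 \<Longrightarrow> p ^ k \<noteq> 0 \<and> total_deg (p ^ k) = k * total_deg p"
proof (induction k)
  case 0
  have "constant_mpoly (1 :: 'a mpoly)"
    unfolding constant_mpoly_iff by (metis const_mpoly_1)
  then show ?case
    using total_deg_0_iff by simp blast
qed (simp add: total_deg_mult)

section \<open>Irreducible polynomials are prime\<close>

lemma dvd_mult_constant:
  assumes "constant_mpoly a" "a \<noteq> 0"
  shows "a * p dvd p"
proof -
  obtain c where c: "const_mpoly (1 / c) * a = 1"
    using assms by (rule constant_mpolyE)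
  have "a * p * const_mpoly (1 / c) = const_mpoly (1 / c) * a * p"
    by (simp add: ac_simps)
  then have "p = a * p * const_mpoly (1 / c)"
    using c by simp
  then show ?thesis
    by (rule dvdI)
qed

text \<open>
  Primality of \<open>f\<close> in the subring \<open>\<real>[x\<^sub>i : i \<in> V]\<close>. By \<open>factor_polys_in\<close>, divisibility between nonzero
  elements of the subring means the same there as in the whole ring.
\<close>

definition prime_in :: "'n::finite set \<Rightarrow> 'n mpoly \<Rightarrow> bool" where
  "prime_in V f \<longleftrightarrow>
     (\<forall>g\<in>polys_in V. \<forall>h\<in>polys_in V. f dvd g * h \<longrightarrow> f dvd g \<or> f dvd h)"

lemma dvd_iff_dvd_coeffs:
  assumes "f \<in> polys_in V" "v \<notin> V"
  shows "f dvd g \<longleftrightarrow> (\<forall>k. f dvd Polynomial.coeff (univ_in v g) k)"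
proof
  assume "f dvd g"
  then obtain h where "g = f * h"
    by (rule dvdE)
  then show "\<forall>k. f dvd Polynomial.coeff (univ_in v g) k"
    using univ_in_free[OF assms] by (simp add: univ_in_mult)
next
  assume *: "\<forall>k. f dvd Polynomial.coeff (univ_in v g) k"
  have "g = poly (univ_in v g) (var_mpoly v)"
    by simp
  also have "\<dots> = (\<Sum>i\<le>Polynomial.degree (univ_in v g). Polynomial.coeff (univ_in v g) i * var_mpoly v ^ i)"
    by (rule poly_altdef)
  also have "f dvd \<dots>"
    using * by (intro dvd_sum dvd_mult2) blast
  finally show "f dvd g" .
qed

text \<open>
  A prime of \<open>R\<close> stays prime in \<open>R[x\<^sub>v]\<close>. If \<open>f\<close> divides neither \<open>g\<close> nor \<open>h\<close>, let \<open>g\<^sub>i\<close> and \<open>h\<^sub>j\<close> be the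
  first coefficients not divisible by \<open>f\<close>; then \<open>f\<close> divides every term of the coefficient of index
  \<open>i + j\<close> of \<open>g h\<close> except \<open>g\<^sub>i h\<^sub>j\<close>.
\<close>

lemma prime_in_insert:
  assumes f: "f \<in> polys_in V" "v \<notin> V" and prime: "prime_in V f"
  shows "prime_in (insert v V) f"
  unfolding prime_in_def
proof (intro ballI impI, rule ccontr)
  fix g h assume gh: "g \<in> polys_in (insert v V)" "h \<in> polys_in (insert v V)"
    and dvd: "f dvd g * h" and neg: "\<not> (f dvd g \<or> f dvd h)"
  let ?g = "Polynomial.coeff (univ_in v g)" and ?h = "Polynomial.coeff (univ_in v h)"
  have "\<exists>i. \<not> f dvd ?g i" "\<exists>j. \<not> f dvd ?h j"
    using neg dvd_iff_dvd_coeffs[OF f, of g] dvd_iff_dvd_coeffs[OF f, of h] by blast+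
  then obtain i j where i: "\<not> f dvd ?g i" "\<And>k. k < i \<Longrightarrow> f dvd ?g k"
    and j: "\<not> f dvd ?h j" "\<And>k. k < j \<Longrightarrow> f dvd ?h k"
    using exists_least_iff[of "\<lambda>i. \<not> f dvd ?g i"] exists_least_iff[of "\<lambda>j. \<not> f dvd ?h j"] by blast
  have "f dvd (\<Sum>k\<le>i + j. ?g k * ?h (i + j - k))"
    using dvd dvd_iff_dvd_coeffs[OF f, of "g * h"] by (simp add: univ_in_mult coeff_mult)
  also have "(\<Sum>k\<le>i + j. ?g k * ?h (i + j - k)) = ?g i * ?h j + (\<Sum>k\<in>{..i + j} - {i}. ?g k * ?h (i + j - k))"
    by (subst sum.remove[of _ i]) auto
  finally have "f dvd ?g i * ?h j + (\<Sum>k\<in>{..i + j} - {i}. ?g k * ?h (i + j - k))" .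
  moreover have "f dvd (\<Sum>k\<in>{..i + j} - {i}. ?g k * ?h (i + j - k))"
  proof (rule dvd_sum)
    fix k assume "k \<in> {..i + j} - {i}"
    then have "k < i \<or> i + j - k < j" by auto
    then show "f dvd ?g k * ?h (i + j - k)"
      using i(2)[of k] j(2)[of "i + j - k"] by (auto intro: dvd_mult dvd_mult2)
  qed
  ultimately have "f dvd ?g i * ?h j"
    by (simp add: dvd_add_left_iff)
  moreover have "?g i \<in> polys_in V" "?h j \<in> polys_in V"
    using coeff_univ_in_polys[of _ v V] gh f(2) by auto
  ultimately show False
    using prime i(1) j(1) by (auto simp: prime_in_def)
qed

text \<open>
  The core of Gauss's lemma: when a nonzero coefficient \<open>a\<close> divides \<open>q r\<close>, cancelling suitable
  coefficients \<open>a\<^sub>1\<close> from \<open>q\<close> and \<open>a\<^sub>2\<close> from \<open>r\<close> turns \<open>q r\<close> into a factorisation of the quotient. If \<open>a\<close> is irreducible this is its primality in \<open>R[x\<^sub>v]\<close>; a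
  reducible \<open>a\<close> is treated one factor after the other.
\<close>

lemma cancel_coefficient_factor:
  assumes v: "v \<notin> V"
    and IH: "\<And>f. f \<in> polys_in V \<Longrightarrow> irreducible_mpoly f \<Longrightarrow> prime_in V f"
    and "a \<in> polys_in V" "a \<noteq> 0"
    and "w \<in> polys_in (insert v V)" "q \<in> polys_in (insert v V)" "r \<in> polys_in (insert v V)"
    and "a * w = q * r"
  shows "\<exists>a1 a2 q' r'. a1 \<in> polys_in V \<and> a2 \<in> polys_in V \<and> a1 \<noteq> 0 \<and> a2 \<noteq> 0 \<and>
    q = a1 * q' \<and> r = a2 * r' \<and> w = q' * r'"
  using assms(3-)
proof (induction "total_deg a" arbitrary: a w q r rule: less_induct)
  case less
  note a = less.prems(1,2) and wqr = less.prems(3-5) and eq = less.prems(6)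
  consider "constant_mpoly a" | "irreducible_mpoly a"
    | b c where "\<not> constant_mpoly b" "\<not> constant_mpoly c" "a = b * c"
    by (auto simp: irreducible_mpoly_def)
  then show ?case
  proof cases
    case 1
    then obtain c where c: "a = const_mpoly c" "c \<noteq> 0" "const_mpoly (1 / c) * a = 1"
      using a by (auto elim: constant_mpolyE)
    have "a * const_mpoly (1 / c) = 1"
      using c(3) by (simp add: mult.commute)
    then have "q = a * (const_mpoly (1 / c) * q)" "r = 1 * r"
      by (simp_all flip: mult.assoc)
    moreover have "w = (const_mpoly (1 / c) * q) * r"
    proof -
      have "w = (const_mpoly (1 / c) * a) * w"
        using c(3) by simp
      also have "\<dots> = const_mpoly (1 / c) * (q * r)"
        unfolding eq[symmetric] by (rule mult.assoc)
      finally show ?thesis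
        by (simp add: mult.assoc)
    qed
    ultimately show ?thesis
      using a unfolding c(1)[symmetric] by (intro exI[of _ a] exI[of _ 1] exI[of _ "const_mpoly (1 / c) * q"] exI[of _ r]) auto
  next
    case 2
    then have "prime_in (insert v V) a"
      using IH a v prime_in_insert by blast
    then have "a dvd q \<or> a dvd r"
      using wqr dvd_triv_left[of a w] unfolding eq prime_in_def by blast
    then show ?thesis
    proof
      assume "a dvd q"
      then obtain q' where q': "q = a * q'" by (rule dvdE)
      then have "w = q' * r"
        using eq a mpoly_mult_left_cancel[of a w "q' * r"] by (simp add: mult.assoc)
      with q' a show ?thesis
        by (intro exI[of _ a] exI[of _ 1] exI[of _ q'] exI[of _ r]) auto
    next
      assume "a dvd r"
      then obtain r' where r': "r = a * r'" by (rule dvdE)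
      then have "w = q * r'"
        using eq a mpoly_mult_left_cancel[of a w "q * r'"] by (simp add: mult.left_commute)
      with r' a show ?thesis
        by (intro exI[of _ 1] exI[of _ a] exI[of _ q] exI[of _ r']) auto
    qed
  next
    case 3
    have bc: "b \<noteq> 0" "c \<noteq> 0"
      using a 3 by auto
    have bcV: "b \<in> polys_in V" "c \<in> polys_in V"
      using a 3 factor_polys_in[of b c V] factor_polys_in[of c b V] by (simp_all add: mult.commute)
    have deg: "total_deg b < total_deg a" "total_deg c < total_deg a"
      using 3 bc total_deg_mult[of b c] total_deg_0_iff[of b] total_deg_0_iff[of c] by auto
    have cw: "c * w \<in> polys_in (insert v V)"
      using bcV wqr polys_in_mono[of V "insert v V"] polys_in_mult by blast
    obtain b1 b2 q1 r1 where b: "b1 \<in> polys_in V" "b2 \<in> polys_in V" "b1 \<noteq> 0" "b2 \<noteq> 0"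
      "q = b1 * q1" "r = b2 * r1" "c * w = q1 * r1"
      using less.hyps[OF deg(1) bcV(1) bc(1) cw wqr(2,3)] eq 3(3) by (auto simp: mult.assoc)
    have qr1: "q1 \<in> polys_in (insert v V)" "r1 \<in> polys_in (insert v V)"
      if "w \<noteq> 0"
    proof -
      have "q1 * r1 \<noteq> 0"
        using that bc unfolding b(7)[symmetric] by simp
      with cw b(7) show "q1 \<in> polys_in (insert v V)" "r1 \<in> polys_in (insert v V)"
        using factor_polys_in[of q1 r1] factor_polys_in[of r1 q1] by (simp_all add: mult.commute)
    qed
    show ?thesis
    proof (cases "w = 0")
      case True
      then have "q1 * r1 = 0"
        using b(7) by simp
      with True b show ?thesis
        by (intro exI[of _ b1] exI[of _ b2] exI[of _ q1] exI[of _ r1]) auto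
    next
      case False
      obtain c1 c2 q2 r2 where c: "c1 \<in> polys_in V" "c2 \<in> polys_in V" "c1 \<noteq> 0" "c2 \<noteq> 0"
        "q1 = c1 * q2" "r1 = c2 * r2" "w = q2 * r2"
        using less.hyps[OF deg(2) bcV(2) bc(2) wqr(1) qr1[OF False] b(7)] by blast
      have "b1 * c1 \<in> polys_in V" "b2 * c2 \<in> polys_in V" "b1 * c1 \<noteq> 0" "b2 * c2 \<noteq> 0"
        using b c by (auto intro: polys_in_mult)
      moreover have "q = (b1 * c1) * q2" "r = (b2 * c2) * r2"
        using b c by (simp_all add: mult.assoc)
      ultimately show ?thesis
        using c(7) by blast
    qed
  qed
qed

text \<open>
  Division with remainder in \<open>x\<^sub>v\<close> without denominators: subtracting a multiple of \<open>r\<close> from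
  \<open>l y\<close>, where \<open>l\<close> is the leading coefficient of \<open>r\<close>, lowers the degree of \<open>y\<close> as long as it is at least
  that of \<open>r\<close>, and the minimality of \<open>r\<close> in the ideal \<open>I\<close> forces the remainder \<open>0\<close>. It replaces the
  principal ideal property of \<open>K[x\<^sub>v]\<close> over the field of fractions \<open>K\<close> of the coefficients.
\<close>

lemma pseudo_multiple_of_minimal:
  fixes r :: "'n::finite mpoly"
  assumes v: "v \<notin> V"
    and diff: "\<And>x y. x \<in> I \<Longrightarrow> y \<in> I \<Longrightarrow> x - y \<in> I"
    and mult: "\<And>s x. s \<in> polys_in (insert v V) \<Longrightarrow> x \<in> I \<Longrightarrow> s * x \<in> I"
    and I: "I \<subseteq> polys_in (insert v V)"
    and r: "r \<in> I" "r \<noteq> 0" and min: "\<And>x. x \<in> I \<Longrightarrow> x \<noteq> 0 \<Longrightarrow> deg_in v r \<le> deg_in v x"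
    and "y \<in> I"
  shows "\<exists>a\<in>polys_in V. a \<noteq> 0 \<and> (\<exists>q\<in>polys_in (insert v V). a * y = q * r)"
  using \<open>y \<in> I\<close>
proof (induction "deg_in v y" arbitrary: y rule: less_induct)
  case less
  show ?case
  proof (cases "y = 0")
    case True
    then show ?thesis
      by (intro bexI[of _ 1] conjI bexI[of _ 0]) auto
  next
    case False
    let ?n = "deg_in v y" and ?m = "deg_in v r"
    define l where "l = Polynomial.lead_coeff (univ_in v r)"
    define k where "k = Polynomial.lead_coeff (univ_in v y)"
    define s where "s = k * var_mpoly v ^ (?n - ?m)"
    define z where "z = l * y - s * r"
    have le: "?m \<le> ?n"
      using min less.prems False by blast
    have lV: "l \<in> polys_in V" and kV: "k \<in> polys_in V"
      using coeff_univ_in_polys[of _ v V] less.prems r(1) I v unfolding l_def k_def by auto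
    have l0: "l \<noteq> 0"
      using r(2) by (simp add: l_def)
    have lW: "l \<in> polys_in (insert v V)" and kW: "k \<in> polys_in (insert v V)"
      using lV kV polys_in_mono[of V "insert v V"] by auto
    have sW: "s \<in> polys_in (insert v V)"
      unfolding s_def by (intro polys_in_mult kW polys_in_var_power) simp
    have zI: "z \<in> I"
      unfolding z_def by (intro diff mult less.prems r(1) lW sW)
    have uz: "univ_in v z = Polynomial.smult l (univ_in v y)
        - Polynomial.smult k (Polynomial.monom 1 (?n - ?m) * univ_in v r)"
      unfolding z_def s_def
      by (simp add: univ_in_diff univ_in_mult univ_in_free[OF lV v] univ_in_free[OF kV v] univ_in_var_power)
    have ex: "\<exists>a\<in>polys_in V. a \<noteq> 0 \<and> (\<exists>q\<in>polys_in (insert v V). a * z = q * r)"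
    proof (cases "z = 0")
      case True
      then show ?thesis
        by (intro bexI[of _ 1] conjI bexI[of _ 0]) auto
    next
      case False
      have "Polynomial.degree (univ_in v z) \<le> ?n"
      proof -
        have "Polynomial.degree (Polynomial.monom 1 (?n - ?m) * univ_in v r) \<le> (?n - ?m) + ?m"
          unfolding deg_in_def using degree_mult_le order_trans
          by (metis (no_types) add_le_mono1 degree_monom_le)
        then show ?thesis
          unfolding uz using le
          by (intro degree_diff_le) (auto simp: deg_in_def intro: order_trans[OF degree_smult_le])
      qed
      moreover have "Polynomial.coeff (univ_in v z) ?n = 0"
        unfolding uz using le by (simp add: coeff_monom_mult l_def k_def deg_in_def)
      ultimately have "Polynomial.degree (univ_in v z) < ?n"
        using False by (metis antisym_conv2 leading_coeff_0_iff univ_in_eq_0_iff)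
      then have "deg_in v z < ?n"
        by (simp add: deg_in_def)
      then show ?thesis
        using less.hyps zI by blast
    qed
    then obtain a q where a: "a \<in> polys_in V" "a \<noteq> 0" "q \<in> polys_in (insert v V)" "a * z = q * r"
      by blast
    have "(a * l) * y = (q + a * s) * r"
      using a(4) unfolding z_def by (simp add: algebra_simps)
    moreover have "q + a * s \<in> polys_in (insert v V)"
      using a sW polys_in_mono[of V "insert v V"] by (blast intro: polys_in_add polys_in_mult)
    moreover have "a * l \<in> polys_in V" "a * l \<noteq> 0"
      using a lV l0 by (auto intro: polys_in_mult)
    ultimately show ?thesis
      by blast
  qed
qed

text \<open>
  Let \<open>f\<close> divide \<open>g h\<close> and let \<open>x\<^sub>v\<close> occur in \<open>f\<close>. A nonzero element \<open>r\<close> of minimal degree in \<open>x\<^sub>v\<close> in the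
  ideal \<open>(f, g)\<close> is a greatest common divisor of \<open>f\<close> and \<open>g\<close> up to factors free of \<open>x\<^sub>v\<close>. Since \<open>f\<close> is
  irreducible, \<open>r\<close> is either a multiple of \<open>f\<close>, and then so is \<open>g\<close>, or free of \<open>x\<^sub>v\<close>, and then
  \<open>r h\<close> is a multiple of \<open>f\<close>, and so is \<open>h\<close>.
\<close>

lemma irreducible_imp_prime_in:
  assumes "finite V" "f \<in> polys_in V" "irreducible_mpoly f"
  shows "prime_in V f"
  using assms
proof (induction V arbitrary: f rule: finite_induct)
  case empty
  then show ?case
    by (simp add: polys_in_empty irreducible_mpoly_def)
next
  case (insert v V)
  let ?W = "insert v V"
  have irred: "constant_mpoly x \<or> constant_mpoly y" if "f = x * y" for x y
    using insert.prems(2) that by (auto simp: irreducible_mpoly_def)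
  have mono: "x \<in> polys_in ?W" if "x \<in> polys_in V" for x
    using that polys_in_mono[of V ?W] by auto
  have f0: "f \<noteq> 0"
    using insert.prems(2) by (metis const_mpoly_0 constant_mpoly_iff irreducible_mpoly_def)
  show ?case
  proof (cases "f \<in> polys_in V")
    case True
    then show ?thesis
      using prime_in_insert[OF True insert.hyps(2) insert.IH[OF True insert.prems(2)]] by simp
  next
    case fV: False
    \<comment> \<open>No nonconstant polynomial free of \<open>x\<^sub>v\<close> divides \<open>f\<close>, so such factors can be cancelled.\<close>
    have cancel: "f dvd y"
      if a: "a \<in> polys_in V" "a \<noteq> 0" and y: "y \<in> polys_in ?W" and dvd: "f dvd a * y" for a y
    proof (cases "y = 0")
      case False
      obtain t where t: "a * y = f * t"
        using dvd by (rule dvdE)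
      have "t \<in> polys_in ?W"
      proof (rule factor_polys_in)
        show "t * f \<in> polys_in ?W"
          using polys_in_mult[OF mono[OF a(1)] y] by (simp add: t mult.commute)
        show "t * f \<noteq> 0"
          using t a False mpoly_mult_eq_0_iff[of a y] by (simp add: mult.commute)
      qed
      then obtain a1 a2 f' t' where a12: "a1 \<in> polys_in V" "a1 \<noteq> 0"
        "f = a1 * f'" "y = f' * t'"
        using cancel_coefficient_factor[OF insert.hyps(2) insert.IH a y insert.prems(1) _ t] by blast
      have "\<not> constant_mpoly f'"
        using fV a12(1) polys_in_mult[OF a12(1), of f'] unfolding a12(3) constant_mpoly_iff by auto
      then have "constant_mpoly a1"
        using irred[OF a12(3)] by blast
      then have "f dvd f'"
        unfolding a12(3) using a12(2) by (rule dvd_mult_constant)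
      then show ?thesis
        using a12(4) by simp
    qed simp
    show ?thesis
      unfolding prime_in_def
    proof (intro ballI impI)
      fix g h assume g: "g \<in> polys_in ?W" and h: "h \<in> polys_in ?W" and dvd: "f dvd g * h"
      \<comment> \<open>The ideal \<open>(f, g)\<close> of \<open>\<real>[x\<^sub>i : i \<in> insert v V]\<close>.\<close>
      define I where "I = {x * f + y * g | x y. x \<in> polys_in ?W \<and> y \<in> polys_in ?W}"
      have diff: "x - y \<in> I" if "x \<in> I" "y \<in> I" for x y
      proof -
        obtain x1 x2 y1 y2 where *: "x = x1 * f + x2 * g" "y = y1 * f + y2 * g"
          "x1 \<in> polys_in ?W" "x2 \<in> polys_in ?W" "y1 \<in> polys_in ?W" "y2 \<in> polys_in ?W"
          using \<open>x \<in> I\<close> \<open>y \<in> I\<close> unfolding I_def by blast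
        then have "x - y = (x1 - y1) * f + (x2 - y2) * g"
          by (simp add: algebra_simps)
        then show ?thesis
          unfolding I_def using * polys_in_diff by blast
      qed
      have mult: "s * x \<in> I" if "s \<in> polys_in ?W" "x \<in> I" for s x
      proof -
        obtain x1 x2 where *: "x = x1 * f + x2 * g" "x1 \<in> polys_in ?W" "x2 \<in> polys_in ?W"
          using \<open>x \<in> I\<close> unfolding I_def by blast
        then have "s * x = (s * x1) * f + (s * x2) * g"
          by (simp add: algebra_simps)
        then show ?thesis
          unfolding I_def using * \<open>s \<in> polys_in ?W\<close> polys_in_mult by blast
      qed
      have IW: "I \<subseteq> polys_in ?W"
        unfolding I_def using g insert.prems(1) by (auto intro!: polys_in_add polys_in_mult)
      have fI: "f \<in> I"
        unfolding I_def by (rule CollectI, rule exI[of _ 1], rule exI[of _ 0]) simp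
      have gI: "g \<in> I"
        unfolding I_def by (rule CollectI, rule exI[of _ 0], rule exI[of _ 1]) simp
      obtain r where r: "r \<in> I" "r \<noteq> 0" and min: "\<And>x. x \<in> I \<Longrightarrow> x \<noteq> 0 \<Longrightarrow> deg_in v r \<le> deg_in v x"
        using fI f0 ex_has_least_nat[of "\<lambda>x. x \<in> I \<and> x \<noteq> 0" f "deg_in v"] by blast
      have multiple: "\<exists>a\<in>polys_in V. a \<noteq> 0 \<and> (\<exists>q\<in>polys_in ?W. a * y = q * r)" if "y \<in> I" for y
        by (rule pseudo_multiple_of_minimal[where I = I])
          (fact insert.hyps(2) diff mult IW r min that)+
      obtain a q where a: "a \<in> polys_in V" "a \<noteq> 0" "q \<in> polys_in ?W" "a * f = q * r"
        using multiple[OF fI] by blast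
      have rW: "r \<in> polys_in ?W"
        using IW r(1) by blast
      obtain a1 a2 q' r' where a12: "a2 \<in> polys_in V" "r = a2 * r'" "f = q' * r'"
        using cancel_coefficient_factor[OF insert.hyps(2) insert.IH a(1,2) insert.prems(1) a(3) rW a(4)]
        by blast
      show "f dvd g \<or> f dvd h"
        using irred[OF a12(3)]
      proof
        assume "constant_mpoly q'"
        moreover have "q' \<noteq> 0"
          using a12(3) f0 by auto
        ultimately have "f dvd r'"
          unfolding a12(3) by (rule dvd_mult_constant)
        then have "f dvd r"
          using a12(2) by simp
        moreover obtain b s where "b \<in> polys_in V" "b \<noteq> 0" "b * g = s * r"
          using multiple[OF gI] by blast
        ultimately show ?thesis
          using cancel[OF _ _ g] by auto
      next
        assume "constant_mpoly r'"
        then have rV: "r \<in> polys_in V"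
          unfolding a12(2) constant_mpoly_iff using a12(1) by (auto intro: polys_in_mult)
        obtain x y where "r = x * f + y * g"
          using r(1) unfolding I_def by blast
        then have "r * h = f * (x * h) + y * (g * h)"
          by (simp add: algebra_simps)
        then have "f dvd r * h"
          using dvd by simp
        then show ?thesis
          using cancel[OF rV r(2) h] by blast
      qed
    qed
  qed
qed

lemma irreducible_mpoly_prime:
  fixes f :: "'n::finite mpoly"
  assumes "irreducible_mpoly f" "f dvd g * h"
  shows "f dvd g \<or> f dvd h"
  using irreducible_imp_prime_in[of UNIV f] assms by (simp add: prime_in_def)

section \<open>Chains of prime ideals in the polynomial ring\<close>

text \<open>
  One step of Gaussian elimination per equation: each equation is solved for one of the unknowns, which
  is then eliminated from the others.
\<close>

lemma homogeneous_system_nontrivial_solution: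
  fixes a :: "'k \<Rightarrow> 'j \<Rightarrow> real"
  assumes "finite K" "finite J" "card K < card J"
  shows "\<exists>u. (\<exists>j\<in>J. u j \<noteq> 0) \<and> (\<forall>k\<in>K. (\<Sum>j\<in>J. a k j * u j) = 0)"
  using assms
proof (induction K arbitrary: J a rule: finite_induct)
  case empty
  then obtain j where "j \<in> J" by fastforce
  then show ?case
    by (intro exI[of _ "\<lambda>_. 1"]) auto
next
  case (insert k K)
  show ?case
  proof (cases "\<forall>j\<in>J. a k j = 0")
    case True
    obtain u where "\<exists>j\<in>J. u j \<noteq> 0" "\<forall>k\<in>K. (\<Sum>j\<in>J. a k j * u j) = 0"
      using insert.IH[of J a] insert.prems insert.hyps by auto
    with True show ?thesis
      by (intro exI[of _ u]) simp
  next
    case False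
    then obtain j0 where j0: "j0 \<in> J" "a k j0 \<noteq> 0" by blast
    define J' where "J' = J - {j0}"
    have J': "finite J'" "card K < card J'"
      using insert.prems insert.hyps j0 by (auto simp: J'_def)
    obtain u where u: "\<exists>j\<in>J'. u j \<noteq> 0"
      "\<And>l. l \<in> K \<Longrightarrow> (\<Sum>j\<in>J'. (a l j - a l j0 * a k j / a k j0) * u j) = 0"
      using insert.IH[OF J', of "\<lambda>l j. a l j - a l j0 * a k j / a k j0"] by blast
    define t where "t = - (\<Sum>j\<in>J'. a k j * u j) / a k j0"
    have split: "(\<Sum>j\<in>J. a l j * (u(j0 := t)) j) = a l j0 * t + (\<Sum>j\<in>J'. a l j * u j)" for l
    proof -
      have "(\<Sum>j\<in>J. a l j * (u(j0 := t)) j) = a l j0 * t + (\<Sum>j\<in>J'. a l j * (u(j0 := t)) j)"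
        unfolding J'_def using insert.prems(1) j0(1) by (subst sum.remove[of _ j0]) auto
      also have "(\<Sum>j\<in>J'. a l j * (u(j0 := t)) j) = (\<Sum>j\<in>J'. a l j * u j)"
        by (rule sum.cong) (auto simp: J'_def)
      finally show ?thesis .
    qed
    have "(\<Sum>j\<in>J. a l j * (u(j0 := t)) j) = 0" if "l \<in> K" for l
    proof -
      have "0 = (\<Sum>j\<in>J'. a l j * u j - a l j0 / a k j0 * (a k j * u j))"
        using u(2)[OF that] by (simp add: algebra_simps)
      also have "\<dots> = (\<Sum>j\<in>J'. a l j * u j) - a l j0 / a k j0 * (\<Sum>j\<in>J'. a k j * u j)"
        by (simp add: sum_subtractf sum_distrib_left)
      finally show ?thesis
        unfolding split by (simp add: t_def)
    qed
    moreover have "(\<Sum>j\<in>J. a k j * (u(j0 := t)) j) = 0"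
      unfolding split using j0 by (simp add: t_def)
    moreover have "\<exists>j\<in>J. (u(j0 := t)) j \<noteq> 0"
      using u(1) by (auto simp: J'_def)
    ultimately show ?thesis
      by (intro exI[of _ "u(j0 := t)"]) auto
  qed
qed

text \<open>
  Bounding the exponents separately, instead of their sum, makes the monomials a box, so that they
  are easily counted.
\<close>

definition bounded_exponents :: "nat \<Rightarrow> ('n::finite \<Rightarrow>\<^sub>0 nat) set" where
  "bounded_exponents M = {\<alpha>. \<forall>i. Poly_Mapping.lookup \<alpha> i \<le> M}"

lemma bounded_exponents_mono: "M \<le> N \<Longrightarrow> bounded_exponents M \<subseteq> bounded_exponents N"
  by (auto simp: bounded_exponents_def intro: order_trans)

lemma card_bounded_exponents:
  "finite (bounded_exponents M :: ('n::finite \<Rightarrow>\<^sub>0 nat) set)"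
  "card (bounded_exponents M :: ('n \<Rightarrow>\<^sub>0 nat) set) \<le> (M + 1) ^ CARD('n)"
proof -
  let ?B = "bounded_exponents M :: ('n \<Rightarrow>\<^sub>0 nat) set"
  let ?F = "PiE (UNIV :: 'n set) (\<lambda>_. {..M})"
  have inj: "inj_on Poly_Mapping.lookup ?B" by (simp add: inj_on_def)
  have sub: "Poly_Mapping.lookup ` ?B \<subseteq> ?F" by (auto simp: bounded_exponents_def PiE_def)
  have fin: "finite ?F" by (intro finite_PiE) auto
  show "finite ?B"
    using inj finite_subset[OF sub fin] by (rule inj_on_finite[OF _ order_refl])
  show "card ?B \<le> (M + 1) ^ CARD('n)"
    using card_inj_on_le[OF inj sub fin] by (simp add: card_PiE)
qed

lemma keys_bounded:
  fixes p :: "'n::finite mpoly"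
  shows "\<exists>M. Poly_Mapping.keys p \<subseteq> bounded_exponents M"
proof (intro exI subsetI)
  fix \<alpha> assume \<alpha>: "\<alpha> \<in> Poly_Mapping.keys p"
  have "Poly_Mapping.lookup \<alpha> i \<le> (\<Sum>\<alpha>\<in>Poly_Mapping.keys p. \<Sum>i\<in>UNIV. Poly_Mapping.lookup \<alpha> i)" for i
  proof -
    have "Poly_Mapping.lookup \<alpha> i \<le> (\<Sum>i\<in>UNIV. Poly_Mapping.lookup \<alpha> i)"
      by (rule member_le_sum) auto
    also have "\<dots> \<le> (\<Sum>\<alpha>\<in>Poly_Mapping.keys p. \<Sum>i\<in>UNIV. Poly_Mapping.lookup \<alpha> i)"
      using \<alpha> by (intro member_le_sum[of \<alpha> _ "\<lambda>\<alpha>. \<Sum>i\<in>UNIV. Poly_Mapping.lookup \<alpha> i"]) auto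
    finally show ?thesis .
  qed
  then show "\<alpha> \<in> bounded_exponents (\<Sum>\<alpha>\<in>Poly_Mapping.keys p. \<Sum>i\<in>UNIV. Poly_Mapping.lookup \<alpha> i)"
    by (simp add: bounded_exponents_def)
qed

lemma keys_mult_bounded:
  assumes "Poly_Mapping.keys p \<subseteq> bounded_exponents M" "Poly_Mapping.keys q \<subseteq> bounded_exponents N"
  shows "Poly_Mapping.keys (p * q) \<subseteq> bounded_exponents (M + N)"
proof
  fix \<alpha> assume "\<alpha> \<in> Poly_Mapping.keys (p * q)"
  then obtain \<beta> \<gamma> where "\<alpha> = \<beta> + \<gamma>" "\<beta> \<in> Poly_Mapping.keys p" "\<gamma> \<in> Poly_Mapping.keys q"
    using Poly_Mapping.keys_mult[of p q] by blast
  with assms show "\<alpha> \<in> bounded_exponents (M + N)"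
    by (auto simp: bounded_exponents_def lookup_add intro!: add_mono)
qed

lemma keys_power_bounded:
  assumes "Poly_Mapping.keys p \<subseteq> bounded_exponents M"
  shows "Poly_Mapping.keys (p ^ k) \<subseteq> bounded_exponents (k * M)"
proof (induction k)
  case 0
  then show ?case by (simp add: bounded_exponents_def)
next
  case (Suc k)
  then show ?case using keys_mult_bounded[OF assms Suc] by simp
qed

lemma keys_prod_bounded:
  assumes "\<And>i. i \<in> I \<Longrightarrow> Poly_Mapping.keys (p i) \<subseteq> bounded_exponents (M i)"
  shows "Poly_Mapping.keys (\<Prod>i\<in>I. p i) \<subseteq> bounded_exponents (\<Sum>i\<in>I. M i)"
  using assms
proof (induction I rule: infinite_finite_induct)
  case (insert i I)
  then show ?case using keys_mult_bounded[of "p i" "M i"] by simp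
qed (simp_all add: bounded_exponents_def)

lemma lookup_const_mult: "Poly_Mapping.lookup (const_mpoly c * p) \<alpha> = c * Poly_Mapping.lookup p \<alpha>"
  by (simp add: const_mpoly_def map.rep_eq when_def flip: mult_map_scale_conv_mult)

text \<open>
  Any \<open>d + 1\<close> polynomials in \<open>d\<close> variables are algebraically dependent. There are \<open>(N + 1)\<^bsup>d+1\<^esup>\<close> products
  of their powers with exponents at most \<open>N\<close>, but only \<open>(N D + 1)\<^sup>d\<close> monomials can occur in these products,
  where \<open>D\<close> depends only on the polynomials; for large \<open>N\<close> the products are linearly dependent. The
  exponent vectors of the relation are functions on \<open>{..d}\<close>, extended by a fixed value elsewhere, so that
  different ones stand for different monomials.
\<close>

lemma algebraic_dependence:
  fixes x :: "nat \<Rightarrow> 'n::finite mpoly"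
  defines "d \<equiv> CARD('n)"
  shows "\<exists>E c. finite E \<and> E \<noteq> {} \<and> E \<subseteq> PiE {..d} (\<lambda>_. UNIV) \<and> (\<forall>e\<in>E. c e \<noteq> 0) \<and>
     (\<Sum>e\<in>E. const_mpoly (c e) * (\<Prod>i\<le>d. x i ^ e i)) = 0"
proof -
  obtain M where M: "\<And>i. Poly_Mapping.keys (x i) \<subseteq> bounded_exponents (M i)"
    using keys_bounded[of "x _"] by metis
  define D where "D = (\<Sum>i\<le>d. M i)"
  \<comment> \<open>Chosen so that \<open>(N D + 1)\<^sup>d \<le> (N + 1)\<^sup>d (D + 1)\<^sup>d = (N + 1)\<^sup>d N < (N + 1)\<^bsup>d+1\<^esup>\<close>.\<close>
  define N where "N = (D + 1) ^ d"
  define E0 where "E0 = PiE {..d} (\<lambda>_. {..N})"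
  define K :: "('n \<Rightarrow>\<^sub>0 nat) set" where "K = bounded_exponents (N * D)"
  define y where "y e = (\<Prod>i\<le>d. x i ^ e i)" for e
  have keys_y: "Poly_Mapping.keys (y e) \<subseteq> K" if "e \<in> E0" for e
  proof -
    have "Poly_Mapping.keys (y e) \<subseteq> bounded_exponents (\<Sum>i\<le>d. e i * M i)"
      unfolding y_def by (intro keys_prod_bounded keys_power_bounded M)
    also have "(\<Sum>i\<le>d. e i * M i) \<le> (\<Sum>i\<le>d. N * M i)"
      using that by (intro sum_mono mult_right_mono) (auto simp: E0_def PiE_def)
    then have "bounded_exponents (\<Sum>i\<le>d. e i * M i) \<subseteq> K"
      unfolding K_def D_def by (intro bounded_exponents_mono) (simp add: sum_distrib_left)
    finally show ?thesis .
  qed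
  have fin: "finite E0"
    unfolding E0_def by (intro finite_PiE) auto
  have "card K \<le> (N * D + 1) ^ d"
    unfolding K_def d_def by (rule card_bounded_exponents)
  also have "\<dots> \<le> ((N + 1) * (D + 1)) ^ d"
    by (intro power_mono) auto
  also have "\<dots> = (N + 1) ^ d * N"
    by (simp only: power_mult_distrib N_def)
  also have "\<dots> < (N + 1) ^ (d + 1)"
    by simp
  also have "\<dots> = card E0"
    by (simp add: E0_def card_PiE)
  finally have "card K < card E0" .
  then obtain u where u: "\<exists>e\<in>E0. u e \<noteq> 0"
    "\<And>\<alpha>. \<alpha> \<in> K \<Longrightarrow> (\<Sum>e\<in>E0. Poly_Mapping.lookup (y e) \<alpha> * u e) = 0"
    using homogeneous_system_nontrivial_solution[of K E0 "\<lambda>\<alpha> e. Poly_Mapping.lookup (y e) \<alpha>"]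
      card_bounded_exponents(1) fin unfolding K_def by blast
  define E where "E = {e \<in> E0. u e \<noteq> 0}"
  have "(\<Sum>e\<in>E. const_mpoly (u e) * y e) = (\<Sum>e\<in>E0. const_mpoly (u e) * y e)"
    unfolding E_def using fin by (intro sum.mono_neutral_left) auto
  also have "\<dots> = 0"
  proof (rule poly_mapping_eqI)
    fix \<alpha>
    show "Poly_Mapping.lookup (\<Sum>e\<in>E0. const_mpoly (u e) * y e) \<alpha> = Poly_Mapping.lookup 0 \<alpha>"
    proof (cases "\<alpha> \<in> K")
      case True
      then show ?thesis
        using u(2)[OF True] unfolding lookup_sum lookup_const_mult by (simp add: mult.commute)
    next
      case False
      then have "Poly_Mapping.lookup (y e) \<alpha> = 0" if "e \<in> E0" for e
        using keys_y[OF that] by (auto simp: in_keys_iff)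
      then show ?thesis
        by (simp add: lookup_sum lookup_const_mult)
    qed
  qed
  finally have "(\<Sum>e\<in>E. const_mpoly (u e) * y e) = 0" .
  moreover have "finite E" "E \<noteq> {}" "\<forall>e\<in>E. u e \<noteq> 0"
    using fin u(1) by (auto simp: E_def)
  moreover have "E \<subseteq> PiE {..d} (\<lambda>_. UNIV)"
    by (auto simp: E_def E0_def PiE_def)
  ultimately show ?thesis
    unfolding y_def by blast
qed

text \<open>
  Prime ideals in terms of the type class operations; \<open>prime_ideal_mpoly_of_primeideal\<close> below connects
  them with prime ideals of the ring record.
\<close>

locale prime_ideal_mpoly =
  fixes P :: "'n::finite mpoly set"
  assumes zero: "0 \<in> P" and one: "1 \<notin> P"
    and add: "p \<in> P \<Longrightarrow> q \<in> P \<Longrightarrow> p + q \<in> P"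
    and mult: "p \<in> P \<Longrightarrow> r * p \<in> P"
    and prime: "p * q \<in> P \<Longrightarrow> p \<in> P \<or> q \<in> P"
begin

lemma sum_mem: "(\<And>i. i \<in> I \<Longrightarrow> p i \<in> P) \<Longrightarrow> sum p I \<in> P"
  by (induction I rule: infinite_finite_induct) (auto intro: zero add)

lemma add_cancel_right: "p + q \<in> P \<Longrightarrow> q \<in> P \<Longrightarrow> p \<in> P"
  using add[of "p + q" "- q"] mult[of q "- 1"] by simp

lemma power_mult_cancel: "x ^ k * p \<in> P \<Longrightarrow> x \<notin> P \<Longrightarrow> p \<in> P"
  by (induction k) (use prime in \<open>auto simp: mult.assoc\<close>)

end

text \<open>
  The ring has Krull dimension at most \<open>d\<close>. Take \<open>x\<^sub>k\<close> in \<open>P\<^bsub>k+1\<^esub>\<close> but not in \<open>P\<^sub>k\<close> for \<open>k \<le> d\<close> and an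
  algebraic relation between them. The invariant is that a nontrivial polynomial expression in
  \<open>x\<^sub>k, \<dots>, x\<^sub>d\<close> lies in \<open>P\<^sub>k\<close>: dividing by the largest possible power of \<open>x\<^sub>k\<close> stays in \<open>P\<^sub>k\<close> as \<open>x\<^sub>k\<close> is
  not in that prime ideal, and dropping the terms that still contain \<open>x\<^sub>k\<close> stays in \<open>P\<^bsub>k+1\<^esub>\<close>.
\<close>

theorem prime_chain_length_bound:
  fixes P :: "nat \<Rightarrow> 'n::finite mpoly set"
  defines "d \<equiv> CARD('n)"
  assumes prime: "\<And>k. k \<le> d + 1 \<Longrightarrow> prime_ideal_mpoly (P k)"
    and chain: "\<And>k. k \<le> d \<Longrightarrow> P k \<subset> P (Suc k)"
  shows False
proof -
  have "\<exists>x. \<forall>k\<le>d. x k \<in> P (Suc k) - P k"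
    using chain by (intro choice) blast
  then obtain x where x: "\<And>k. k \<le> d \<Longrightarrow> x k \<in> P (Suc k) - P k"
    by blast
  obtain E0 c where E0: "finite E0" "E0 \<noteq> {}" "E0 \<subseteq> PiE {..d} (\<lambda>_. UNIV)" "\<And>e. e \<in> E0 \<Longrightarrow> c e \<noteq> 0"
    "(\<Sum>e\<in>E0. const_mpoly (c e) * (\<Prod>i\<le>d. x i ^ e i)) = 0"
    using algebraic_dependence[of x] unfolding d_def by blast
  \<comment> \<open>Members of \<open>E\<close> are determined by their values from \<open>k\<close> on, so different terms are different monomials.\<close>
  have "\<exists>E\<subseteq>E0. E \<noteq> {} \<and> (\<forall>e\<in>E. \<forall>e'\<in>E. (\<forall>i\<in>{k..d}. e i = e' i) \<longrightarrow> e = e') \<and>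
      (\<Sum>e\<in>E. const_mpoly (c e) * (\<Prod>i\<in>{k..d}. x i ^ e i)) \<in> P k" if "k \<le> d + 1" for k
    using that
  proof (induction k)
    case 0
    have "\<forall>e\<in>E0. \<forall>e'\<in>E0. (\<forall>i\<in>{0..d}. e i = e' i) \<longrightarrow> e = e'"
      using E0(3) by (auto intro!: PiE_ext[of _ "{..d}" "\<lambda>_. UNIV"])
    moreover have "0 \<in> P 0"
      using prime[of 0] by (simp add: prime_ideal_mpoly.zero)
    ultimately show ?case
      using E0(2,5) by (intro exI[of _ E0]) (simp add: atLeast0AtMost)
  next
    case (Suc k)
    then have k: "k \<le> d" by simp
    interpret Pk: prime_ideal_mpoly "P k" by (rule prime) (use k in simp)
    interpret PS: prime_ideal_mpoly "P (Suc k)" by (rule prime) (use k in simp)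
    let ?mon = "\<lambda>e. const_mpoly (c e) * (\<Prod>i\<in>{Suc k..d}. x i ^ e i)"
    obtain E where E: "E \<subseteq> E0" "E \<noteq> {}" "\<forall>e\<in>E. \<forall>e'\<in>E. (\<forall>i\<in>{k..d}. e i = e' i) \<longrightarrow> e = e'"
      "(\<Sum>e\<in>E. const_mpoly (c e) * (\<Prod>i\<in>{k..d}. x i ^ e i)) \<in> P k"
      using Suc by auto
    have finE: "finite E"
      using E(1) E0(1) finite_subset by blast
    define m where "m = Min ((\<lambda>e. e k) ` E)"
    have m: "m \<le> e k" if "e \<in> E" for e
      unfolding m_def using that finE by (intro Min_le) auto
    have "m \<in> (\<lambda>e. e k) ` E"
      unfolding m_def using finE E(2) by (intro Min_in) auto
    then obtain e0 where e0: "e0 \<in> E" "e0 k = m" by auto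
    define E' where "E' = {e \<in> E. e k = m}"
    have "(\<Sum>e\<in>E. const_mpoly (c e) * (\<Prod>i\<in>{k..d}. x i ^ e i))
        = (\<Sum>e\<in>E. x k ^ m * (x k ^ (e k - m) * ?mon e))"
    proof (rule sum.cong)
      fix e assume "e \<in> E"
      have "(\<Prod>i\<in>{k..d}. x i ^ e i) = x k ^ e k * (\<Prod>i\<in>{Suc k..d}. x i ^ e i)"
        using k by (simp add: prod.atLeast_Suc_atMost)
      also have "x k ^ e k = x k ^ m * x k ^ (e k - m)"
        using m[OF \<open>e \<in> E\<close>] by (simp flip: power_add)
      finally show "const_mpoly (c e) * (\<Prod>i\<in>{k..d}. x i ^ e i) = x k ^ m * (x k ^ (e k - m) * ?mon e)"
        by (simp add: ac_simps)
    qed simp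
    then have "x k ^ m * (\<Sum>e\<in>E. x k ^ (e k - m) * ?mon e) \<in> P k"
      using E(4) by (simp add: sum_distrib_left)
    then have "(\<Sum>e\<in>E. x k ^ (e k - m) * ?mon e) \<in> P k"
      using x[OF k] by (auto intro: Pk.power_mult_cancel)
    then have "(\<Sum>e\<in>E. x k ^ (e k - m) * ?mon e) \<in> P (Suc k)"
      using chain[OF k] by blast
    also have "(\<Sum>e\<in>E. x k ^ (e k - m) * ?mon e)
        = (\<Sum>e\<in>E'. ?mon e) + (\<Sum>e\<in>E - E'. x k ^ (e k - m) * ?mon e)"
    proof -
      have "(\<Sum>e\<in>E. x k ^ (e k - m) * ?mon e)
        = (\<Sum>e\<in>E'. x k ^ (e k - m) * ?mon e) + (\<Sum>e\<in>E - E'. x k ^ (e k - m) * ?mon e)"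
        unfolding E'_def by (subst add.commute, rule sum.subset_diff) (use finE in auto)
      also have "(\<Sum>e\<in>E'. x k ^ (e k - m) * ?mon e) = (\<Sum>e\<in>E'. ?mon e)"
        by (rule sum.cong) (auto simp: E'_def)
      finally show ?thesis .
    qed
    finally have "(\<Sum>e\<in>E'. ?mon e) + (\<Sum>e\<in>E - E'. x k ^ (e k - m) * ?mon e) \<in> P (Suc k)" .
    moreover have "(\<Sum>e\<in>E - E'. x k ^ (e k - m) * ?mon e) \<in> P (Suc k)"
    proof (rule PS.sum_mem)
      fix e assume "e \<in> E - E'"
      then have "e k - m = Suc (e k - m - 1)"
        using m[of e] by (auto simp: E'_def)
      then have "x k ^ (e k - m) * ?mon e = (x k ^ (e k - m - 1) * ?mon e) * x k"
        by (metis (no_types, lifting) mult.assoc mult.commute power_Suc)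
      then show "x k ^ (e k - m) * ?mon e \<in> P (Suc k)"
        using x[OF k] PS.mult by auto
    qed
    ultimately have "(\<Sum>e\<in>E'. ?mon e) \<in> P (Suc k)"
      by (rule PS.add_cancel_right)
    moreover have "e = e'" if "e \<in> E'" "e' \<in> E'" "\<forall>i\<in>{Suc k..d}. e i = e' i" for e e'
    proof -
      have "e i = e' i" if "i \<in> {k..d}" for i
        using that \<open>e \<in> E'\<close> \<open>e' \<in> E'\<close> \<open>\<forall>i\<in>{Suc k..d}. e i = e' i\<close>
        by (cases "i = k") (auto simp: E'_def)
      with E(3) that show ?thesis
        by (auto simp: E'_def)
    qed
    moreover have "E' \<subseteq> E0" "E' \<noteq> {}"
      using E(1) e0 by (auto simp: E'_def)
    ultimately show ?case
      by blast
  qed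
  from this[of "d + 1"] obtain E where E: "E \<subseteq> E0" "E \<noteq> {}" "\<forall>e\<in>E. \<forall>e'\<in>E. e = e'"
      "(\<Sum>e\<in>E. const_mpoly (c e)) \<in> P (d + 1)"
    by auto
  then obtain e where e: "E = {e}" by blast
  then have "const_mpoly (c e) \<in> P (d + 1)" "c e \<noteq> 0"
    using E E0(4) by auto
  moreover from this have "const_mpoly (1 / c e) * const_mpoly (c e) = 1"
    by (simp add: const_mpoly_mult)
  ultimately show False
    using prime[of "d + 1"] prime_ideal_mpoly.mult prime_ideal_mpoly.one by (metis order_refl)
qed

section \<open>Polynomials vanishing on a set of dimension \<open>d - 1\<close>\<close>

lemma prime_ideal_mpoly_of_primeideal:
  fixes Q :: "'n::finite mpoly set"
  assumes "primeideal Q ring_of_type_algebra"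
  shows "prime_ideal_mpoly Q"
proof -
  let ?R = "ring_of_type_algebra :: 'n mpoly ring"
  interpret Q: primeideal Q ?R by (rule assms)
  show ?thesis
  proof
    show "0 \<in> Q"
      using additive_subgroup.zero_closed[OF Q.is_additive_subgroup] by (simp add: ring_of_type_algebra_def)
    show "1 \<notin> Q"
      using Q.one_imp_carrier Q.I_notcarr by (auto simp: ring_of_type_algebra_def)
    show "p + q \<in> Q" if "p \<in> Q" "q \<in> Q" for p q
      using additive_subgroup.a_closed[OF Q.is_additive_subgroup that] by (simp add: ring_of_type_algebra_def)
    show "r * p \<in> Q" if "p \<in> Q" for p r
      using Q.I_l_closed[OF that, of r] by (simp add: ring_of_type_algebra_def)
    show "p \<in> Q \<or> q \<in> Q" if "p * q \<in> Q" for p q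
      using Q.I_prime[of p q] that by (simp add: ring_of_type_algebra_def)
  qed
qed

text \<open>
  Preimages under the projection to the quotient; strictness is preserved because the projection is
  surjective.
\<close>

lemma prime_chain_of_quotient:
  fixes I :: "'n::finite mpoly set" and P :: "nat \<Rightarrow> 'n mpoly set set"
  defines "R \<equiv> ring_of_type_algebra :: 'n mpoly ring"
  assumes I: "ideal I R"
    and P: "\<And>k. k \<le> n \<Longrightarrow> primeideal (P k) (R Quot I)"
    and chain: "\<And>k. k < n \<Longrightarrow> P k \<subset> P (Suc k)"
  obtains Q where "\<And>k. k \<le> n \<Longrightarrow> prime_ideal_mpoly (Q k)" "\<And>k. k \<le> n \<Longrightarrow> I \<subseteq> Q k"
    "\<And>k. k < n \<Longrightarrow> Q k \<subset> Q (Suc k)"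
proof -
  have cring: "cring R"
    unfolding R_def by (rule cring_from_type_algebra)
  interpret I: ideal I R by (rule I)
  define Q where "Q k = {p \<in> carrier R. I +>\<^bsub>R\<^esub> p \<in> P k}" for k
  have carrier: "p \<in> carrier R" for p
    by (simp add: R_def ring_of_type_algebra_def)
  show thesis
  proof
    fix k assume k: "k \<le> n"
    have "primeideal (Q k) R"
      unfolding Q_def by (rule ring_hom_ring.primeideal_vimage[OF I.rcos_ring_hom_ring cring P[OF k]])
    then show "prime_ideal_mpoly (Q k)"
      unfolding R_def by (rule prime_ideal_mpoly_of_primeideal)
    show "I \<subseteq> Q k"
    proof
      fix p assume "p \<in> I"
      then have "I +>\<^bsub>R\<^esub> p = \<zero>\<^bsub>R Quot I\<^esub>"
        by (simp add: FactRing_def I.a_rcos_const)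
      moreover have "\<zero>\<^bsub>R Quot I\<^esub> \<in> P k"
        using primeideal.axioms(1)[OF P[OF k]] ideal.axioms(1) additive_subgroup.zero_closed by blast
      ultimately show "p \<in> Q k"
        by (simp add: Q_def carrier)
    qed
  next
    fix k assume k: "k < n"
    obtain Y where Y: "Y \<in> P (Suc k)" "Y \<notin> P k"
      using chain[OF k] by blast
    have "Y \<in> carrier (R Quot I)"
      using P[of "Suc k"] k Y(1) by (auto intro: ideal.Icarr[OF primeideal.axioms(1)])
    then obtain p where "Y = I +>\<^bsub>R\<^esub> p"
      by (auto simp: FactRing_def A_RCOSETS_def')
    then have "p \<in> Q (Suc k)" "p \<notin> Q k"
      using Y by (auto simp: Q_def carrier)
    moreover have "Q k \<subseteq> Q (Suc k)"
      using chain[OF k] by (auto simp: Q_def)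
    ultimately show "Q k \<subset> Q (Suc k)"
      by blast
  qed
qed

lemma irreducible_mpoly_nonzero: "irreducible_mpoly f \<Longrightarrow> f \<noteq> 0"
  by (metis const_mpoly_0 constant_mpoly_iff irreducible_mpoly_def)

lemma not_dvd_1_irreducible:
  fixes f :: "'n::finite mpoly"
  assumes "irreducible_mpoly f"
  shows "\<not> f dvd 1"
proof
  assume "f dvd 1"
  then obtain g where g: "1 = f * g" by (rule dvdE)
  have "f * g \<in> polys_in {}"
    unfolding g[symmetric] by simp
  moreover have "f * g \<noteq> 0"
    unfolding g[symmetric] by simp
  ultimately have "f \<in> polys_in {}"
    by (rule factor_polys_in)
  with assms show False
    by (simp add: polys_in_empty irreducible_mpoly_def)
qed

text \<open>
  Since \<open>f\<close> vanishes on \<open>S\<close>, the dimension \<open>d - 1\<close> is as large as \<open>f\<close> allows. A polynomial \<open>h\<close> that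
  vanishes on \<open>S\<close> and is not divisible by \<open>f\<close> would make \<open>(f)\<close> a proper subset of all the prime ideals in
  the chain, which could then be prolonged by two at its lower end.
\<close>

lemma dvd_if_vanishes_on_hypersurface_piece:
  fixes S :: "(real ^ 'n::finite) set"
  assumes dim: "semialg_dim S = ereal (real CARD('n) - 1)"
    and f: "irreducible_mpoly f" "f \<in> vanishing_ideal S" and h: "h \<in> vanishing_ideal S"
  shows "f dvd h"
proof (rule ccontr)
  assume ndvd: "\<not> f dvd h"
  let ?d = "CARD('n)" and ?R = "ring_of_type_algebra :: 'n mpoly ring" and ?I = "vanishing_ideal S"
  have "\<exists>n P. ?d \<le> n + 1 \<and> (\<forall>i\<le>n. primeideal (P i) (?R Quot ?I)) \<and> (\<forall>i<n. P i \<subset> P (Suc i))"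
  proof (rule ccontr)
    assume neg: "\<not> ?thesis"
    \<comment> \<open>If all chains were too short, the supremum would be too small: lengths are integers.\<close>
    have "semialg_dim S \<le> ereal (real ?d - 2)"
      unfolding semialg_dim_def krull_dim_def
    proof (rule Sup_least)
      fix y assume "y \<in> {ereal (real n) | n.
          \<exists>P. (\<forall>i\<le>n. primeideal (P i) (?R Quot ?I)) \<and> (\<forall>i<n. P i \<subset> P (Suc i))}"
      then obtain n where "y = ereal (real n)" "\<not> ?d \<le> n + 1"
        using neg by blast
      then show "y \<le> ereal (real ?d - 2)"
        by simp
    qed
    with dim show False by simp
  qed
  then obtain n P where n: "?d \<le> n + 1"
    and P: "\<And>i. i \<le> n \<Longrightarrow> primeideal (P i) (?R Quot ?I)" "\<And>i. i < n \<Longrightarrow> P i \<subset> P (Suc i)"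
    by blast
  obtain Q where Q: "\<And>k. k \<le> n \<Longrightarrow> prime_ideal_mpoly (Q k)" "\<And>k. k \<le> n \<Longrightarrow> ?I \<subseteq> Q k"
      "\<And>k. k < n \<Longrightarrow> Q k \<subset> Q (Suc k)"
    by (rule prime_chain_of_quotient[where P = P, OF ideal_vanishing_ideal P], assumption, assumption, rule that)
  define C where "C k = (if k = 0 then {0} else if k = 1 then {g. f dvd g} else Q (k - 2))" for k
  have prime0: "prime_ideal_mpoly {0 :: 'n mpoly}"
    by unfold_locales auto
  have primef: "prime_ideal_mpoly {g. f dvd g}"
  proof
    show "g \<in> {g. f dvd g} \<or> h \<in> {g. f dvd g}" if "g * h \<in> {g. f dvd g}" for g h
      using irreducible_mpoly_prime[OF f(1), of g h] that by simp
  qed (use not_dvd_1_irreducible[OF f(1)] in auto)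
  show False
  proof (rule prime_chain_length_bound)
    fix k assume "k \<le> CARD('n) + 1"
    then have "k - 2 \<le> n"
      using n by simp
    then show "prime_ideal_mpoly (C k)"
      unfolding C_def using prime0 primef Q(1)[of "k - 2"] by auto
  next
    fix k assume k: "k \<le> CARD('n)"
    consider "k = 0" | "k = 1" | j where "k = j + 2"
    proof -
      have "k = 0 \<or> k = 1 \<or> k = (k - 2) + 2" by linarith
      then show thesis using that by blast
    qed
    then show "C k \<subset> C (Suc k)"
    proof cases
      case 1
      moreover have "{0} \<subset> {g. f dvd g}"
      proof
        show "{0} \<subseteq> {g. f dvd g}" by simp
        show "{0} \<noteq> {g. f dvd g}"
          using irreducible_mpoly_nonzero[OF f(1)] dvd_refl[of f] by blast
      qed
      ultimately show ?thesis
        by (simp add: C_def)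
    next
      case 2
      interpret Q0: prime_ideal_mpoly "Q 0" by (rule Q(1)) simp
      have "f \<in> Q 0" "h \<in> Q 0"
        using f(2) h Q(2)[of 0] by auto
      have "{g. f dvd g} \<subseteq> Q 0"
      proof
        fix g assume "g \<in> {g. f dvd g}"
        then obtain q where "g = f * q" by (blast elim: dvdE)
        then show "g \<in> Q 0"
          using Q0.mult[OF \<open>f \<in> Q 0\<close>, of q] by (simp add: mult.commute)
      qed
      then have "{g. f dvd g} \<subset> Q 0"
        using ndvd \<open>h \<in> Q 0\<close> by blast
      then show ?thesis
        using 2 by (simp add: C_def)
    next
      case 3
      then show ?thesis
        using Q(3)[of j] k n by (simp add: C_def)
    qed
  qed
qed

section \<open>Partial derivatives\<close>

definition partial_deriv :: "'n \<Rightarrow> 'n mpoly \<Rightarrow> 'n mpoly" where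
  "partial_deriv v p = (\<Sum>\<alpha>\<in>Poly_Mapping.keys p.
     Poly_Mapping.single (\<alpha> - Poly_Mapping.single v 1)
       (Poly_Mapping.lookup p \<alpha> * real (Poly_Mapping.lookup \<alpha> v)))"

lemma partial_deriv_superset:
  assumes "finite K" "Poly_Mapping.keys p \<subseteq> K"
  shows "partial_deriv v p = (\<Sum>\<alpha>\<in>K.
     Poly_Mapping.single (\<alpha> - Poly_Mapping.single v 1)
       (Poly_Mapping.lookup p \<alpha> * real (Poly_Mapping.lookup \<alpha> v)))"
  unfolding partial_deriv_def
  by (rule sum.mono_neutral_left) (use assms in \<open>auto simp: in_keys_iff\<close>)

lemma partial_deriv_0 [simp]: "partial_deriv v 0 = 0"
  by (simp add: partial_deriv_def)

lemma partial_deriv_single: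
  "partial_deriv v (Poly_Mapping.single \<alpha> c) =
     Poly_Mapping.single (\<alpha> - Poly_Mapping.single v 1) (c * real (Poly_Mapping.lookup \<alpha> v))"
  by (subst partial_deriv_superset[where K = "{\<alpha>}"]) auto

lemma partial_deriv_add: "partial_deriv v (p + q) = partial_deriv v p + partial_deriv v q"
proof -
  let ?K = "Poly_Mapping.keys p \<union> Poly_Mapping.keys q"
  have "Poly_Mapping.keys (p + q) \<subseteq> ?K"
    by (rule Poly_Mapping.keys_add)
  then show ?thesis
    by (simp add: partial_deriv_superset[where K = ?K] lookup_add distrib_right single_add sum.distrib)
qed

text \<open>
  Where the truncated subtraction of exponents falls short of the true one, the coefficient is \<open>0\<close>.
\<close>

lemma single_minus_var_add:
  "Poly_Mapping.single (\<alpha> + \<beta> - Poly_Mapping.single v 1) (c * real (Poly_Mapping.lookup \<alpha> v))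
    = Poly_Mapping.single (\<alpha> - Poly_Mapping.single v 1 + \<beta>) (c * real (Poly_Mapping.lookup \<alpha> v))"
proof (cases "Poly_Mapping.lookup \<alpha> v = 0")
  case False
  have "\<alpha> + \<beta> - Poly_Mapping.single v 1 = \<alpha> - Poly_Mapping.single v 1 + \<beta>"
    by (rule poly_mapping_eqI) (use False in \<open>auto simp: lookup_add lookup_minus lookup_single when_def\<close>)
  then show ?thesis by simp
qed simp

lemma partial_deriv_mult: "partial_deriv v (p * q) = partial_deriv v p * q + p * partial_deriv v q"
proof (induction p rule: mpoly_induct)
  case 1
  then show ?case by simp
next
  case (2 \<alpha> c r)
  let ?s = "Poly_Mapping.single \<alpha> c"
  have "partial_deriv v (?s * q) = partial_deriv v ?s * q + ?s * partial_deriv v q"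
  proof (induction q rule: mpoly_induct)
    case 1
    then show ?case by simp
  next
    case (2 \<beta> b q)
    have "partial_deriv v (?s * Poly_Mapping.single \<beta> b)
        = Poly_Mapping.single (\<alpha> + \<beta> - Poly_Mapping.single v 1) (c * b * real (Poly_Mapping.lookup \<alpha> v))
        + Poly_Mapping.single (\<beta> + \<alpha> - Poly_Mapping.single v 1) (c * b * real (Poly_Mapping.lookup \<beta> v))"
      by (simp add: mult_single partial_deriv_single lookup_add distrib_left single_add add.commute)
    also have "\<dots> = partial_deriv v ?s * Poly_Mapping.single \<beta> b + ?s * partial_deriv v (Poly_Mapping.single \<beta> b)"
      unfolding single_minus_var_add
      by (simp add: mult_single partial_deriv_single ac_simps)
    finally show ?case
      using 2 by (simp add: partial_deriv_add distrib_left)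
  qed
  with 2 show ?case
    by (simp add: partial_deriv_add distrib_right)
qed

text \<open>
  Partial differentiation is differentiation of the univariate polynomial in \<open>x\<^sub>v\<close>; this gives the degree
  and the leading coefficient of the derivative.
\<close>

lemma coeff_univ_in_partial_deriv:
  "Polynomial.coeff (univ_in v (partial_deriv v p)) k
     = const_mpoly (real (Suc k)) * Polynomial.coeff (univ_in v p) (Suc k)"
proof (induction p rule: mpoly_induct)
  case 1
  then show ?case by simp
next
  case (2 \<alpha> c q)
  have rem: "remove_var v (\<alpha> - Poly_Mapping.single v 1) = remove_var v \<alpha>"
    by (rule poly_mapping_eqI) (simp add: lookup_remove_var lookup_minus lookup_single when_def)
  have "Polynomial.coeff (univ_in v (partial_deriv v (Poly_Mapping.single \<alpha> c))) k
     = const_mpoly (real (Suc k)) * Polynomial.coeff (univ_in v (Poly_Mapping.single \<alpha> c)) (Suc k)"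
    by (cases "Poly_Mapping.lookup \<alpha> v")
      (auto simp: partial_deriv_single univ_in_single rem[simplified] lookup_minus const_mpoly_def mult_single mult.commute)
  with 2 show ?case
    by (simp add: partial_deriv_add univ_in_add distrib_left)
qed

lemma not_dvd_partial_deriv:
  fixes f :: "'n::finite mpoly"
  assumes "deg_in v f > 0"
  shows "\<not> f dvd partial_deriv v f"
proof
  assume "f dvd partial_deriv v f"
  then obtain g where g: "partial_deriv v f = f * g" by (rule dvdE)
  define n where "n = deg_in v f - 1"
  have n: "deg_in v f = Suc n"
    using assms by (simp add: n_def)
  then have "f \<noteq> 0"
    by (auto simp: deg_in_def)
  then have "Polynomial.coeff (univ_in v f) (Suc n) \<noteq> 0"
    unfolding n[symmetric] by (simp add: deg_in_def)
  then have "Polynomial.coeff (univ_in v (partial_deriv v f)) n \<noteq> 0"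
    by (simp add: coeff_univ_in_partial_deriv)
  then have "partial_deriv v f \<noteq> 0"
    by auto
  then have "g \<noteq> 0" using g by auto
  then have "deg_in v f \<le> deg_in v (partial_deriv v f)"
    using \<open>f \<noteq> 0\<close> by (simp add: g deg_in_mult)
  moreover have "deg_in v (partial_deriv v f) \<le> n"
    unfolding deg_in_def
    by (rule degree_le) (use n in \<open>simp add: coeff_univ_in_partial_deriv coeff_eq_0 deg_in_def\<close>)
  ultimately show False
    using n by simp
qed

definition line_point :: "real ^ 'n \<Rightarrow> 'n \<Rightarrow> real \<Rightarrow> real ^ 'n" where
  "line_point x v t = (\<chi> i. if i = v then t else x $ i)"

lemma has_derivative_eval_on_line:
  "((\<lambda>t. eval_mpoly p (line_point x v t)) has_real_derivative
     eval_mpoly (partial_deriv v p) (line_point x v t)) (at t)"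
proof (induction p rule: mpoly_induct)
  case 1
  then show ?case by simp
next
  case (2 \<alpha> c q)
  let ?n = "Poly_Mapping.lookup \<alpha> v"
  let ?C = "\<Prod>i\<in>UNIV - {v}. x $ i ^ Poly_Mapping.lookup \<alpha> i"
  have *: "(\<Prod>i\<in>UNIV. line_point x v s $ i ^ Poly_Mapping.lookup \<beta> i) = s ^ Poly_Mapping.lookup \<beta> v * ?C"
    if "\<And>i. i \<noteq> v \<Longrightarrow> Poly_Mapping.lookup \<beta> i = Poly_Mapping.lookup \<alpha> i" for s \<beta>
    by (subst prod.remove[of _ v]) (auto simp: line_point_def that intro!: prod.cong)
  have "((\<lambda>t. c * (t ^ ?n * ?C)) has_real_derivative c * real ?n * (t ^ (?n - 1) * ?C)) (at t)"
    by (auto intro!: derivative_eq_intros)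
  moreover have "(\<lambda>s. eval_mpoly (Poly_Mapping.single \<alpha> c) (line_point x v s)) = (\<lambda>s. c * (s ^ ?n * ?C))"
    by (simp add: *)
  moreover have "eval_mpoly (partial_deriv v (Poly_Mapping.single \<alpha> c)) (line_point x v t)
      = c * real ?n * (t ^ (?n - 1) * ?C)"
    unfolding partial_deriv_single eval_mpoly_single
    by (subst *) (auto simp: lookup_minus lookup_single when_def)
  ultimately have "((\<lambda>t. eval_mpoly (Poly_Mapping.single \<alpha> c) (line_point x v t)) has_real_derivative
      eval_mpoly (partial_deriv v (Poly_Mapping.single \<alpha> c)) (line_point x v t)) (at t)"
    by (simp only:)
  from DERIV_add[OF this 2] show ?case
    by (simp add: partial_deriv_add)
qed

lemma partial_deriv_eq_0_at_minimum:
  fixes x :: "real ^ 'n::finite"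
  assumes "open U" "x \<in> U" and min: "\<And>y. y \<in> U \<Longrightarrow> eval_mpoly p x \<le> eval_mpoly p y"
  shows "eval_mpoly (partial_deriv v p) x = 0"
proof -
  obtain r where r: "r > 0" "ball x r \<subseteq> U"
    using assms(1,2) openE by blast
  have self: "line_point x v (x $ v) = x"
    by (simp add: line_point_def vec_eq_iff)
  have dist: "dist x (line_point x v t) = \<bar>x $ v - t\<bar>" for t
  proof -
    have "x - line_point x v t = axis v (x $ v - t)"
      by (auto simp: line_point_def axis_def vec_eq_iff)
    then show ?thesis
      by (simp add: dist_norm norm_eq_sqrt_inner inner_axis_axis)
  qed
  have "eval_mpoly (partial_deriv v p) (line_point x v (x $ v)) = 0"
  proof (rule DERIV_local_min[OF has_derivative_eval_on_line r(1)], intro allI impI)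
    fix t assume "\<bar>x $ v - t\<bar> < r"
    then have "line_point x v t \<in> U"
      using r(2) dist by auto
    then show "eval_mpoly p (line_point x v (x $ v)) \<le> eval_mpoly p (line_point x v t)"
      unfolding self by (rule min)
  qed
  then show ?thesis
    by (simp add: self)
qed

section \<open>Multiplicities and the boundary\<close>

lemma continuous_on_eval_mpoly: "continuous_on A (eval_mpoly p)"
  unfolding eval_mpoly_def by (intro continuous_intros)

lemma open_positivity_set: "open (positivity_set m p)"
proof -
  have "positivity_set m p = (\<Inter>i\<in>{1..m}. {x. 0 < eval_mpoly (p i) x})"
    by (auto simp: positivity_set_def)
  then show ?thesis
    by (auto intro!: open_INT open_Collect_less continuous_on_const continuous_on_eval_mpoly)
qed

lemma frontier_positivity_set:
  assumes "x \<in> frontier (positivity_set m p)"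
  shows "\<exists>i\<in>{1..m}. eval_mpoly (p i) x = 0"
proof -
  have "x \<notin> positivity_set m p" "x \<in> closure (positivity_set m p)"
    using assms open_positivity_set[of m p] by (auto simp: frontier_def interior_open)
  then obtain i where i: "i \<in> {1..m}" "eval_mpoly (p i) x \<le> 0"
    by (auto simp: positivity_set_def not_less)
  have "closed {x. 0 \<le> eval_mpoly (p i) x}"
    by (intro closed_Collect_le continuous_on_const continuous_on_eval_mpoly)
  moreover have "positivity_set m p \<subseteq> {x. 0 \<le> eval_mpoly (p i) x}"
    using i(1) by (auto simp: positivity_set_def intro: less_imp_le)
  ultimately have "0 \<le> eval_mpoly (p i) x"
    using \<open>x \<in> closure _\<close> closure_minimal by blast
  with i show ?thesis by (intro bexI[of _ i]) auto
qed

lemma eval_mpoly_1 [simp]: "eval_mpoly 1 x = 1"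
  by (simp flip: single_one)

lemma eval_mpoly_prod: "eval_mpoly (\<Prod>i\<in>I. p i) x = (\<Prod>i\<in>I. eval_mpoly (p i) x)"
  by (induction I rule: infinite_finite_induct) auto

lemma eval_mpoly_power: "eval_mpoly (p ^ k) x = eval_mpoly p x ^ k"
  by (induction k) auto

lemma irreducible_mpoly_dvd_prod:
  fixes f :: "'n::finite mpoly"
  assumes "irreducible_mpoly f" "f dvd (\<Prod>i\<in>I. p i)"
  shows "\<exists>i\<in>I. f dvd p i"
  using assms(2)
proof (induction I rule: infinite_finite_induct)
  case (insert i I)
  then show ?case
    using irreducible_mpoly_prime[OF assms(1), of "p i" "prod p I"] by auto
qed (use not_dvd_1_irreducible[OF assms(1)] in auto)

text \<open>
  If \<open>f\<^sup>k\<close> divides \<open>p\<close>, then \<open>k\<close> is at most the degree of \<open>p\<close> because \<open>f\<close> has positive degree.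
\<close>

lemma multiplicity_exists:
  fixes f p :: "'n::finite mpoly"
  assumes f: "irreducible_mpoly f" and p: "p \<noteq> 0" "f dvd p"
  obtains k where "has_multiplicity f p k"
proof -
  have bound: "k \<le> total_deg p" if dvd: "f ^ k dvd p" for k
  proof -
    obtain g where g: "p = f ^ k * g" using dvd by (rule dvdE)
    then have "g \<noteq> 0" using p by auto
    have "k \<le> k * total_deg f"
      using f total_deg_0_iff[of f] by (simp add: irreducible_mpoly_def)
    also have "\<dots> \<le> total_deg p"
      using total_deg_power[OF irreducible_mpoly_nonzero[OF f], of k] \<open>g \<noteq> 0\<close>
      by (simp add: g total_deg_mult)
    finally show ?thesis .
  qed
  define k where "k = (GREATEST k. f ^ k dvd p)"
  have "f ^ k dvd p"
    unfolding k_def by (rule GreatestI_nat[of _ 1 "total_deg p"]) (use p bound in auto)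
  moreover have le: "j \<le> k" if "f ^ j dvd p" for j
    unfolding k_def by (rule Greatest_le_nat[of _ _ "total_deg p"]) (use that bound in auto)
  moreover have "1 \<le> k" "\<not> f ^ (k + 1) dvd p"
    using le[of 1] le[of "k + 1"] p by auto
  ultimately show thesis
    using that by (auto simp: has_multiplicity_def)
qed

theorem corollary1p4:
  fixes m :: nat
    and p :: "nat \<Rightarrow> 'n::finite mpoly"
    and f :: "'n mpoly"
    and A :: "(real ^ 'n) set"
    and b :: "real ^ 'n"
    and \<epsilon> :: real
  assumes "\<And>i. i \<in> {1..m} \<Longrightarrow> p i \<noteq> 0"
    and "A = positivity_set m p"
    and "irreducible_mpoly f"
    and "b \<in> zero_set f" and "\<epsilon> > 0"
    and "semialg_dim (frontier A \<inter> zero_set f \<inter> ball b \<epsilon>) = ereal (real CARD('n) - 1)"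
    and "ball b \<epsilon> - zero_set f = A \<inter> ball b \<epsilon>"
  shows "(\<exists>i\<in>{1..m}. f dvd p i) \<and>
         (\<forall>i\<in>{1..m}. f dvd p i \<longrightarrow> (\<exists>k. has_multiplicity f (p i) k \<and> even k))"
proof -
  note f = assms(3)
  let ?S = "frontier A \<inter> zero_set f \<inter> ball b \<epsilon>"
  have fS: "f \<in> vanishing_ideal ?S"
    by (auto simp: vanishing_ideal_def zero_set_def)
  note dvd = dvd_if_vanishes_on_hypersurface_piece[OF assms(6) f fS]
  have "(\<Prod>i\<in>{1..m}. p i) \<in> vanishing_ideal ?S"
    using frontier_positivity_set[of _ m p] unfolding assms(2)
    by (auto simp: vanishing_ideal_def eval_mpoly_prod)
  then have "\<exists>i\<in>{1..m}. f dvd p i"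
    using dvd irreducible_mpoly_dvd_prod[OF f] by blast
  moreover have "\<exists>k. has_multiplicity f (p i) k \<and> even k" if i: "i \<in> {1..m}" "f dvd p i" for i
  proof -
    obtain k where k: "has_multiplicity f (p i) k"
      using multiplicity_exists[OF f assms(1)[OF i(1)] i(2)] .
    have "even k"
    proof (rule ccontr)
      assume odd: "odd k"
      obtain g where g: "p i = f ^ k * g" "\<not> f dvd g"
      proof -
        obtain g where g: "p i = f ^ k * g"
          using k by (auto simp: has_multiplicity_def elim: dvdE)
        have "\<not> f dvd g"
        proof
          assume "f dvd g"
          then have "f ^ k * f dvd p i"
            unfolding g by (rule mult_dvd_mono[OF dvd_refl])
          with k show False
            by (simp add: has_multiplicity_def mult.commute)
        qed
        from that[OF g this] show thesis .
      qed
      \<comment> \<open>For odd \<open>k\<close> the signs of \<open>f\<^sup>k g\<close> and \<open>f g\<close> agree.\<close>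
      have nonneg: "0 \<le> eval_mpoly (f * g) x" if x: "x \<in> ball b \<epsilon>" for x
      proof (cases "x \<in> zero_set f")
        case True
        then show ?thesis by (simp add: zero_set_def)
      next
        case False
        then have "x \<in> A"
          using x assms(7) by blast
        then have "0 < eval_mpoly (p i) x"
          using i(1) assms(2) by (auto simp: positivity_set_def)
        then have "0 < eval_mpoly f x ^ k * eval_mpoly g x"
          by (simp add: g(1) eval_mpoly_power)
        then show ?thesis
          using odd by (auto simp: zero_less_mult_iff zero_le_mult_iff zero_less_power_eq power_less_zero_eq)
      qed
      obtain v where v: "deg_in v f > 0"
        using f by (auto simp: irreducible_mpoly_def polys_in_iff_deg simp flip: polys_in_empty)
      have "partial_deriv v (f * g) \<in> vanishing_ideal ?S"
        unfolding vanishing_ideal_def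
      proof (intro CollectI ballI)
        fix x assume x: "x \<in> ?S"
        \<comment> \<open>The value \<open>0\<close> at \<open>x\<close> is minimal in the ball.\<close>
        show "eval_mpoly (partial_deriv v (f * g)) x = 0"
        proof (rule partial_deriv_eq_0_at_minimum)
          show "eval_mpoly (f * g) x \<le> eval_mpoly (f * g) y" if "y \<in> ball b \<epsilon>" for y
            using nonneg[OF that] x by (simp add: zero_set_def)
        qed (use x in auto)
      qed
      then have "f dvd partial_deriv v f * g + f * partial_deriv v g"
        using dvd by (simp add: partial_deriv_mult)
      then have "f dvd partial_deriv v f * g"
        by (simp add: dvd_add_left_iff)
      then show False
        using irreducible_mpoly_prime[OF f] not_dvd_partial_deriv[OF v] g(2) by blast
    qed
    with k show ?thesis by blast
  qed
  ultimately show ?thesis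
    by blast
qed

end
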